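(* Let $q \ge 3$ be a prime power and let $V_2$ be a non-degenerate Hermitian surface in $\mathbb{P}^3$ over $\mathbb{F}_{q^2}$. If $F \in \mathbb{F}_{q^2}[x_0,x_1,x_2,x_3]$ is a nonzero homogeneous polynomial of degree $3$ with $|\mathsf{V}(F)\cap V_2| = 3(q^3+q^2-q)+q+1$, then $V(F)$ is a union of three planes tangent to $V_2$ containing a common line which intersects $V_2$ at precisely $q+1$ $\mathbb{F}_{q^2}$-rational points.
   Context: A non-degenerate Hermitian surface $V_2$ is the zero set in $\mathbb{P}^3$ of $x^T A x^{(q)}$, where $x=(x_0,x_1,x_2,x_3)^T$, $x^{(q)}=(x_0^q,x_1^q,x_2^q,x_3^q)^T$, and $A=(a_{ij})$ is an invertible $4\times 4$ matrix over $\mathbb{F}_{q^2}$ with $A^T=A^{(q)}:=(a_{ij}^q)$. $V(F)$ is the zero set of $F$ in $\mathbb{P}^3$ over the algebraic closure $\overline{\mathbb{F}}_q$, and $\mathsf{V}(F)$ is its set of $\mathbb{F}_{q^2}$-rational points. In cardinalities, $V_2$ is understood as its set of $\mathbb{F}_{q^2}$-rational points. Planes and lines are defined over $\mathbb{F}_{q^2}$. A plane is tangent to $V_2$ if it is the tangent plane of $V_2$ at some $\mathbb{F}_{q^2}$-rational point of $V_2$. *)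

theory Defs
  imports
    "HOL-Analysis.Cartesian_Space"
    "HOL-Library.Poly_Mapping"
    "HOL-Library.Numeral_Type"
    "HOL-Algebra.Algebraic_Closure_Type"
    "HOL-Number_Theory.Prime_Powers"
begin

section \<open>Polynomials in finitely many variables\<close>

text \<open>A polynomial maps each exponent vector to its coefficient; the variables are indexed
  by the finite type \<open>'n\<close>. The ring operations are those of \<^theory>\<open>HOL-Library.Poly_Mapping\<close>.\<close>

type_synonym ('n, 'k) mpol = "('n \<Rightarrow>\<^sub>0 nat) \<Rightarrow>\<^sub>0 'k"

definition mp_const :: "'k::zero \<Rightarrow> ('n, 'k) mpol" where
  "mp_const c = Poly_Mapping.single 0 c"

definition mp_var :: "'n \<Rightarrow> ('n, 'k::zero_neq_one) mpol" where
  "mp_var i = Poly_Mapping.single (Poly_Mapping.single i 1) 1"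

definition mp_eval :: "('n::finite, 'k::comm_semiring_1) mpol \<Rightarrow> 'k ^ 'n \<Rightarrow> 'k" where
  "mp_eval F x =
     (\<Sum>m\<in>Poly_Mapping.keys F. Poly_Mapping.lookup F m * (\<Prod>i\<in>UNIV. (x $ i) ^ Poly_Mapping.lookup m i))"

definition mp_homogeneous :: "nat \<Rightarrow> ('n::finite, 'k::zero) mpol \<Rightarrow> bool" where
  "mp_homogeneous d F \<longleftrightarrow>
     (\<forall>m\<in>Poly_Mapping.keys F. (\<Sum>i\<in>UNIV. Poly_Mapping.lookup m i) = d)"

text \<open>Formal partial derivative. In the summands with exponent \<open>0\<close> at \<open>i\<close> the subtraction
  of exponents is truncated, but the coefficient vanishes.\<close>

definition mp_pderiv :: "'n \<Rightarrow> ('n, 'k::comm_semiring_1) mpol \<Rightarrow> ('n, 'k) mpol" where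
  "mp_pderiv i F =
     (\<Sum>m\<in>Poly_Mapping.keys F.
        Poly_Mapping.single (m - Poly_Mapping.single i 1)
          (of_nat (Poly_Mapping.lookup m i) * Poly_Mapping.lookup F m))"

section \<open>Projective space\<close>

text \<open>Points of projective space are the one-dimensional subspaces of the underlying vector
  space; a projective subspace is represented by a linear subspace \<open>U\<close>, and
  \<open>proj_points U\<close> is its set of points.\<close>

definition proj_points :: "('k::field ^ 'n::finite) set \<Rightarrow> ('k ^ 'n) set set" where
  "proj_points U = {P. vec.subspace P \<and> vec.dim P = 1 \<and> P \<subseteq> U}"

definition is_line :: "('k::field ^ 'n::finite) set \<Rightarrow> bool" where
  "is_line L \<longleftrightarrow> vec.subspace L \<and> vec.dim L = 2"

definition is_plane :: "('k::field ^ 'n::finite) set \<Rightarrow> bool" where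
  "is_plane W \<longleftrightarrow> vec.subspace W \<and> vec.dim W = 3"

text \<open>The zero set over the field of coefficients, meant for homogeneous polynomials.\<close>

definition zero_points :: "('n::finite, 'k::field) mpol \<Rightarrow> ('k ^ 'n) set set" where
  "zero_points F = {P \<in> proj_points UNIV. \<forall>x\<in>P. mp_eval F x = 0}"

text \<open>The zero set over the algebraic closure, and the base change of a linear subspace to it.\<close>

definition zero_points_ac :: "('n::finite, 'k::field) mpol \<Rightarrow> ('k alg_closure ^ 'n) set set" where
  "zero_points_ac F = zero_points (Poly_Mapping.map to_ac F)"

definition extend_ac :: "('k::field ^ 'n::finite) set \<Rightarrow> ('k alg_closure ^ 'n) set" where
  "extend_ac U = vec.span ((\<lambda>x. \<chi> i. to_ac (x $ i)) ` U)"

text \<open>The tangent space at \<open>P\<close> of the hypersurface given by \<open>G\<close>. For homogeneous \<open>G\<close>, all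
  non-zero \<open>p \<in> P\<close> give the same linear condition up to a non-zero factor, and if the degree
  is at least \<open>2\<close> then \<open>p = 0\<close> imposes no condition.\<close>

definition tangent_space ::
  "('n::finite, 'k::field) mpol \<Rightarrow> ('k ^ 'n) set \<Rightarrow> ('k ^ 'n) set" where
  "tangent_space G P = {x. \<forall>p\<in>P. (\<Sum>i\<in>UNIV. mp_eval (mp_pderiv i G) p * x $ i) = 0}"

definition is_tangent_plane :: "('n::finite, 'k::field) mpol \<Rightarrow> ('k ^ 'n) set \<Rightarrow> bool" where
  "is_tangent_plane G W \<longleftrightarrow> is_plane W \<and> (\<exists>P\<in>zero_points G. W = tangent_space G P)"

section \<open>Hermitian surfaces\<close>

text \<open>To be used over a field with \<open>q\<^sup>2\<close> elements, on which \<open>a \<mapsto> a ^ q\<close> is an involutory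
  automorphism. \<open>hermitian_pol q A\<close> is the polynomial $x^T A x^{(q)}$ in the coordinates of \<open>x\<close>.\<close>

definition nondeg_hermitian :: "nat \<Rightarrow> 'k::field ^ 'n ^ 'n::finite \<Rightarrow> bool" where
  "nondeg_hermitian q A \<longleftrightarrow> invertible A \<and> transpose A = (\<chi> i j. (A $ i $ j) ^ q)"

definition hermitian_pol :: "nat \<Rightarrow> 'k::field ^ 'n ^ 'n::finite \<Rightarrow> ('n, 'k) mpol" where
  "hermitian_pol q A = (\<Sum>i\<in>UNIV. \<Sum>j\<in>UNIV. mp_var i * mp_const (A $ i $ j) * mp_var j ^ q)"

end

theory Submission
  imports Defs "HOL-Number_Theory.Residues"
begin

text \<open>
  Let \<open>K\<close> be the field with \<open>q\<^sup>2\<close> elements. Whether a rational point lies on \<open>V(F)\<close> depends only on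
  the function that \<open>F\<close> defines on \<open>K\<^sup>4\<close>, so the geometry is done with homogeneous polynomial
  functions (\<open>form\<close>). A linear factor of such a function can be split off as soon as the function
  vanishes on the rational points of a plane (\<open>form_factor\<close>).

  The heart of the matter is a bound on the number of points of the surface that lie on the zero set
  of a form \<open>f\<close> of degree \<open>d \<le> q\<close> vanishing on no rational plane (\<open>section_without_plane\<close>). Let \<open>\<ell>\<close>
  be a generator, that is, a line on the surface. The planes through \<open>\<ell>\<close> are the tangent planes at
  its \<open>q\<^sup>2 + 1\<close> points, and the tangent plane at \<open>P\<close> meets the surface in \<open>\<ell>\<close> and at most \<open>q\<close> further
  generators through \<open>P\<close>. These generators cover the surface (\<open>count_V2\<close>). If \<open>f\<close> vanishes on no
  generator at all, then each of them carries at most \<open>d\<close> zeros, which is few enough. Otherwise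
  let \<open>f\<close> vanish on \<open>\<ell>\<close>, with multiplicity \<open>e \<ge> 1\<close>. In the tangent plane at \<open>P\<close> there remains a curve of
  degree \<open>m = d - e\<close>. If it contains \<open>k\<close> of the other generators through \<open>P\<close>, then removing them
  leaves degree \<open>m - k\<close>, so that \<open>P\<close> contributes at most \<open>m q + k (q\<^sup>2 - q)\<close> points.

  The numbers \<open>k\<close> have sum at most \<open>q e + m\<close>: put \<open>P = p0 + t p1\<close>. The tangent plane at \<open>P\<close> depends
  on \<open>t\<close> only through \<open>t\<^sup>q\<close>, so the leading term of \<open>f\<close> along \<open>\<ell>\<close>, restricted to the tangent plane at
  the moving point, is a nonzero polynomial in \<open>t\<close> of degree at most \<open>q e + m\<close> (\<open>contact\<close>). Since
  \<open>T\<^sup>q - t\<^sup>q = (T - t)\<^sup>q\<close>, the tangent plane is stationary to order \<open>q\<close>. Hence \<open>k\<close> lines through \<open>P\<close>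
  force a zero of order \<open>k\<close> (\<open>section_at_bound\<close>), and at the point at infinity they force the degree
  to drop by \<open>k\<close> (\<open>section_inf_bound\<close>). Altogether there are at most \<open>d q\<^sup>3 + (d - 1) q\<^sup>2 + 1\<close> points
  (\<open>pencil_count\<close>, \<open>count_containing_generator\<close>).

  For \<open>q \<ge> 3\<close> this is too small for a cubic form with the prescribed number of points, and also for
  the quadratic cofactor of a plane. So the cubic form is a product of three linear forms
  (\<open>form_product_of_planes\<close>). A plane that is not tangent contains no generator and hence at most
  \<open>q\<^sup>3 + q + 2\<close> points, a tangent plane contains at most \<open>q\<^sup>3 + q\<^sup>2 + 1\<close>, and two tangent planes share
  at least \<open>q + 1\<close>. With inclusion and exclusion the prescribed number leaves only three distinct
  tangent planes through a common line with exactly \<open>q + 1\<close> points (\<open>extremal_cubic_form\<close>).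

  Finally, both \<open>F\<close> and the product of the linear forms have degree at most \<open>3 < q\<^sup>2\<close> along every
  coordinate line, so their equality on \<open>K\<^sup>4\<close> persists over the algebraic closure
  (\<open>form_zero_extends\<close>).
\<close>

(* the dollar sign denotes vector components throughout, never coefficients of power series *)
no_notation fps_nth (infixl "$" 75)

section \<open>Linear forms, planes and lines\<close>

definition lf :: "'k::field ^ 'n::finite \<Rightarrow> 'k ^ 'n \<Rightarrow> 'k" where
  "lf a x = (\<Sum>i\<in>UNIV. a $ i * x $ i)"

definition hyperplane :: "'k::field ^ 'n::finite \<Rightarrow> ('k ^ 'n) set" where
  "hyperplane a = {x. lf a x = 0}"

definition indep2 :: "'k::field ^ 'n::finite \<Rightarrow> 'k ^ 'n \<Rightarrow> bool" where
  "indep2 u v \<longleftrightarrow> (\<forall>\<alpha> \<beta>. \<alpha> *s u + \<beta> *s v = 0 \<longrightarrow> \<alpha> = 0 \<and> \<beta> = 0)"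

lemma lf_zero [simp]: "lf a 0 = 0" "lf 0 x = 0"
  by (simp_all add: lf_def)

lemma lf_linear [simp]:
  "lf a (x + y) = lf a x + lf a y" "lf a (x - y) = lf a x - lf a y" "lf a (c *s x) = c * lf a x"
  "lf (a + b) x = lf a x + lf b x" "lf (a - b) x = lf a x - lf b x" "lf (c *s a) x = c * lf a x"
  by (simp_all add: lf_def sum.distrib sum_subtractf algebra_simps sum_distrib_left)

lemma lf_axis: "lf a (axis i c) = a $ i * c"
proof -
  have "lf a (axis i c) = (\<Sum>j\<in>UNIV. if j = i then a $ i * c else 0)"
    unfolding lf_def by (rule sum.cong) (auto simp: axis_def)
  then show ?thesis by simp
qed

lemma lf_eq_iff: "(\<forall>x. lf a x = lf b x) \<longleftrightarrow> a = b"
proof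
  assume *: "\<forall>x. lf a x = lf b x"
  show "a = b"
  proof (rule vec_eq_iff[THEN iffD2], rule allI)
    fix i show "a $ i = b $ i"
      using spec[OF *, of "axis i 1"] by (simp add: lf_axis)
  qed
qed simp

lemma subspace_hyperplane: "vec.subspace (hyperplane a)"
  by (auto simp: vec.subspace_def hyperplane_def)

lemma ex_lf_eq_one:
  assumes "a \<noteq> 0" shows "\<exists>w. lf a w = 1"
proof -
  obtain x where x: "lf a x \<noteq> 0"
    using assms lf_eq_iff[of a 0] by auto
  have "lf a ((1 / lf a x) *s x) = 1" using x by simp
  then show ?thesis by blast
qed

text \<open>
  If no such \<open>x\<close> existed, then \<open>a\<close> would vanish on the kernel of \<open>b\<close> and hence be a multiple of \<open>b\<close>.
\<close>

lemma ex_dual_vector: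
  assumes "\<And>c. a \<noteq> c *s b"
  shows "\<exists>x. lf a x = 1 \<and> lf b x = 0"
proof -
  have "\<exists>x. lf b x = 0 \<and> lf a x \<noteq> 0"
  proof (rule ccontr)
    assume "\<not> ?thesis"
    then have *: "\<And>x. lf b x = 0 \<Longrightarrow> lf a x = 0" by blast
    show False
    proof (cases "b = 0")
      case True
      then have "\<forall>x. lf a x = lf 0 x" using * by simp
      then have "a = 0" using lf_eq_iff by blast
      then show False using assms[of 0] by simp
    next
      case False
      then obtain w where w: "lf b w = 1" using ex_lf_eq_one by blast
      have "\<forall>x. lf a x = lf (lf a w *s b) x"
      proof
        fix x
        have "lf b (x - lf b x *s w) = 0" using w by simp
        from *[OF this] show "lf a x = lf (lf a w *s b) x" by (simp add: mult.commute)
      qed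
      then show False using assms lf_eq_iff by blast
    qed
  qed
  then obtain x where x: "lf b x = 0" "lf a x \<noteq> 0" by blast
  have "lf a ((1 / lf a x) *s x) = 1 \<and> lf b ((1 / lf a x) *s x) = 0" using x by simp
  then show ?thesis by blast
qed

text \<open>
  The vector \<open>w\<close> spans a complement of the hyperplane in \<open>U\<close>.
\<close>

lemma dim_inter_hyperplane:
  fixes U :: "('k::field ^ 'n::finite) set"
  assumes U: "vec.subspace U" and w: "w \<in> U" "lf a w = 1"
  shows "vec.dim U = vec.dim (U \<inter> hyperplane a) + 1"
proof -
  let ?H = "U \<inter> hyperplane a"
  have H: "vec.subspace ?H" using U subspace_hyperplane by (rule vec.subspace_inter)
  have "w \<notin> ?H" using w by (simp add: hyperplane_def)
  then have nin: "w \<notin> vec.span ?H" using H by (simp add: vec.span_eq_iff[THEN iffD2])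
  have "vec.span (insert w ?H) = U"
  proof
    show "vec.span (insert w ?H) \<subseteq> U" using U w by (intro vec.span_minimal) auto
    show "U \<subseteq> vec.span (insert w ?H)"
    proof
      fix x assume x: "x \<in> U"
      have "x - lf a x *s w \<in> ?H"
        using w x U by (simp add: hyperplane_def vec.subspace_diff vec.subspace_scale)
      then have "x - lf a x *s w \<in> vec.span (insert w ?H)" by (simp add: vec.span_base)
      moreover have "lf a x *s w \<in> vec.span (insert w ?H)"
        by (simp add: vec.span_base vec.span_scale)
      ultimately have "(x - lf a x *s w) + lf a x *s w \<in> vec.span (insert w ?H)"
        by (rule vec.span_add)
      then show "x \<in> vec.span (insert w ?H)" by simp
    qed
  qed
  then have "vec.dim U = vec.dim (insert w ?H)" by (metis vec.dim_span)
  also have "\<dots> = vec.dim ?H + 1" using nin by (simp add: vec.dim_insert)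
  finally show ?thesis .
qed

lemma is_plane_hyperplane:
  fixes a :: "'k::field ^ 4"
  assumes "a \<noteq> 0" shows "is_plane (hyperplane a)"
proof -
  obtain w where "lf a w = 1" using ex_lf_eq_one[OF assms] by blast
  from dim_inter_hyperplane[OF vec.subspace_UNIV _ this]
  have "vec.dim (hyperplane a) = 3" by (simp add: vec_dim_card del: vec.dim_UNIV)
  then show ?thesis by (simp add: is_plane_def subspace_hyperplane)
qed

lemma is_line_inter_hyperplanes:
  fixes a b :: "'k::field ^ 4"
  assumes "a \<noteq> 0" and ab: "\<And>c. b \<noteq> c *s a"
  shows "is_line (hyperplane a \<inter> hyperplane b)"
proof -
  obtain w where "lf b w = 1" "w \<in> hyperplane a"
    using ex_dual_vector[OF ab] by (auto simp: hyperplane_def)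
  from dim_inter_hyperplane[OF subspace_hyperplane this(2,1)]
  have "vec.dim (hyperplane a \<inter> hyperplane b) = 2"
    using is_plane_hyperplane[OF \<open>a \<noteq> 0\<close>] by (simp add: is_plane_def)
  then show ?thesis
    by (simp add: is_line_def subspace_hyperplane vec.subspace_inter)
qed

lemma span_pair: "vec.span {u, v} = {\<alpha> *s u + \<beta> *s v | \<alpha> \<beta>. True}"
proof -
  have "x \<in> vec.span {u, v} \<longleftrightarrow> (\<exists>\<alpha> \<beta>. x = \<alpha> *s u + \<beta> *s v)" for x
    by (auto simp: vec.span_insert vec.span_singleton algebra_simps)
  then show ?thesis by blast
qed

lemma indep2_dim:
  assumes "indep2 u v" shows "vec.dim (vec.span {u, v}) = 2"
proof -
  have v: "v \<noteq> 0" using assms[unfolded indep2_def, rule_format, of 0 1] by auto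
  have "u \<notin> vec.span {v}"
  proof
    assume "u \<in> vec.span {v}"
    then obtain c where "u = c *s v" by (auto simp: vec.span_singleton)
    then have "1 *s u + (- c) *s v = 0" by simp
    then show False using assms unfolding indep2_def by (metis zero_neq_one)
  qed
  then show ?thesis using v by (simp add: vec.dim_insert)
qed

lemma span_pair_eq_line:
  assumes L: "is_line L" and "u \<in> L" "v \<in> L" and uv: "indep2 u v"
  shows "vec.span {u, v} = L"
proof (rule vec.subspace_dim_equal)
  show "vec.subspace L" using L by (simp add: is_line_def)
  then show "vec.span {u, v} \<subseteq> L" using assms by (intro vec.span_minimal) auto
  show "vec.dim (vec.span {u, v}) \<ge> vec.dim L"
    using indep2_dim[OF uv] L by (simp add: is_line_def)
qed simp

lemma proj_points_iff:
  assumes "vec.subspace U"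
  shows "P \<in> proj_points U \<longleftrightarrow> (\<exists>x. x \<noteq> 0 \<and> x \<in> U \<and> P = vec.span {x})"
proof
  assume "P \<in> proj_points U"
  then have P: "vec.subspace P" "vec.dim P = 1" "P \<subseteq> U" by (auto simp: proj_points_def)
  then obtain x where x: "x \<in> P" "x \<noteq> 0" using vec.dim_eq_0[of P] by fastforce
  have "vec.span {x} = P"
    using x P by (intro vec.subspace_dim_equal vec.subspace_span vec.span_minimal) (auto simp: vec.dim_insert)
  then show "\<exists>x. x \<noteq> 0 \<and> x \<in> U \<and> P = vec.span {x}" using x P by blast
next
  assume "\<exists>x. x \<noteq> 0 \<and> x \<in> U \<and> P = vec.span {x}"
  then obtain x where x: "x \<noteq> 0" "x \<in> U" "P = vec.span {x}" by blast
  then have "P \<subseteq> U" using assms by (simp add: vec.span_minimal)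
  then show "P \<in> proj_points U"
    using x by (simp add: proj_points_def vec.dim_insert)
qed

lemma span_singleton_scale:
  assumes "c \<noteq> (0::'k::field)" shows "vec.span {c *s x} = vec.span {x :: 'k ^ 'n::finite}"
proof -
  have "x \<in> vec.span {c *s x}"
    using assms vec.span_scale[OF vec.span_base[of "c *s x" "{c *s x}"], of "1 / c"] by simp
  then show ?thesis
    by (intro subset_antisym vec.span_minimal) (auto intro: vec.span_scale vec.span_base)
qed

lemma span_singleton_eqD:
  assumes "vec.span {x} = vec.span {y :: 'k::field ^ 'n::finite}" "x \<noteq> 0"
  shows "\<exists>c. c \<noteq> 0 \<and> x = c *s y"
proof -
  have "x \<in> vec.span {y}" using assms(1) vec.span_base[of x "{x}"] by simp
  then obtain c where "x = c *s y" by (auto simp: vec.span_singleton)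
  with assms(2) show ?thesis by auto
qed

section \<open>Forms as homogeneous polynomial functions\<close>

text \<open>
  Closing the constants under multiplication by coordinates and under sums gives the homogeneous
  polynomial functions, in a shape that allows linear factors to be split off by induction on the rules.
\<close>

inductive form :: "nat \<Rightarrow> ('k::field ^ 'n::finite \<Rightarrow> 'k) \<Rightarrow> bool" where
  form_const: "form 0 (\<lambda>x. c)"
| form_coord: "form d f \<Longrightarrow> form (Suc d) (\<lambda>x. x $ i * f x)"
| form_add: "form d f \<Longrightarrow> form d g \<Longrightarrow> form d (\<lambda>x. f x + g x)"

lemma form_0: "form d (\<lambda>x. 0)"
proof (induction d)
  case 0 show ?case by (rule form_const)
next
  case (Suc d) from form_coord[OF this] show ?case by simp
qed

lemma form_smult: "form d f \<Longrightarrow> form d (\<lambda>x. c * f x)"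
proof (induction rule: form.induct)
  case (form_const b) show ?case by (rule form.form_const)
next
  case (form_coord d f i)
  from form.form_coord[OF this(2), of i] show ?case by (simp add: algebra_simps)
next
  case (form_add d f g)
  from form.form_add[OF this(3,4)] show ?case by (simp add: algebra_simps)
qed

lemma form_sum: "(\<And>i. i \<in> I \<Longrightarrow> form d (f i)) \<Longrightarrow> form d (\<lambda>x. \<Sum>i\<in>I. f i x)"
  by (induction I rule: infinite_finite_induct) (auto intro: form_0 form_add)

lemma form_lf: "form d f \<Longrightarrow> form (Suc d) (\<lambda>x. lf a x * f x)"
  unfolding lf_def sum_distrib_right mult.assoc
  by (intro form_sum form_smult form_coord)

lemma form_coord_power: "form d f \<Longrightarrow> form (k + d) (\<lambda>x. (x $ i) ^ k * f x)"
proof (induction k)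
  case (Suc k) from form_coord[OF Suc.IH[OF Suc.prems], of i] show ?case by (simp add: mult.assoc)
qed simp

lemma form_monomial:
  assumes "finite I"
  shows "form (\<Sum>i\<in>I. m i) (\<lambda>x. c * (\<Prod>i\<in>I. (x $ i) ^ m i))"
  using assms
proof (induction I)
  case empty show ?case using form_const[of c] by simp
next
  case (insert i I)
  from form_coord_power[OF insert.IH, of "m i" i] show ?case
    using insert.hyps by (simp add: algebra_simps)
qed

lemma form_mp_eval: "mp_homogeneous d F \<Longrightarrow> form d (mp_eval F)"
  unfolding mp_eval_def mp_homogeneous_def
proof (rule form_sum)
  fix m assume *: "\<forall>m\<in>Poly_Mapping.keys F. (\<Sum>i\<in>UNIV. Poly_Mapping.lookup m i) = d"
    and "m \<in> Poly_Mapping.keys F"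
  then show "form d (\<lambda>x. Poly_Mapping.lookup F m * (\<Prod>i\<in>UNIV. (x $ i) ^ Poly_Mapping.lookup m i))"
    using form_monomial[of UNIV "Poly_Mapping.lookup m" "Poly_Mapping.lookup F m"] by simp
qed

lemma form_scale: "form d f \<Longrightarrow> f (c *s x) = c ^ d * f x"
  by (induction rule: form.induct) (simp_all add: algebra_simps)

lemma form_lf_eq: "form 1 f \<Longrightarrow> \<exists>a. \<forall>x. f x = lf a x"
proof (induction "1::nat" f rule: form.induct)
  case (form_coord d f i)
  have "\<exists>c. \<forall>x. f x = c" using form_coord(1) form_coord(3)
    by (metis One_nat_def form_scale old.nat.inject power_0 mult_1 vec.scale_zero_left)
  then obtain c where c: "\<And>x. f x = c" by blast
  have "x $ i * f x = lf (axis i c) x" for x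
  proof -
    have "lf (axis i c) x = (\<Sum>j\<in>UNIV. if j = i then c * x $ i else 0)"
      unfolding lf_def by (rule sum.cong) (auto simp: axis_def)
    then show ?thesis by (simp add: c)
  qed
  then show ?case by blast
next
  case (form_add f g)
  then obtain a b where "\<forall>x. f x = lf a x" "\<forall>x. g x = lf b x" by blast
  then have "\<forall>x. f x + g x = lf (a + b) x" by simp
  then show ?case by blast
qed simp

text \<open>
  For \<open>lf a w = 1\<close> the map \<open>x \<mapsto> x - lf a x *s w\<close> is the projection onto the hyperplane of \<open>a\<close> along
  \<open>w\<close>. Modulo the linear form \<open>a\<close> it does not change \<open>x\<close>, so it changes the value of \<open>f\<close> only by a
  multiple of \<open>lf a x\<close>. Over a finite field this makes the factor theorem independent of the question
  whether a function determines its polynomial.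
\<close>

lemma form_projection:
  fixes f :: "'k::field ^ 'n::finite \<Rightarrow> 'k"
  assumes "form d f"
  shows "\<exists>g. (if d = 0 then g = (\<lambda>x. 0) else form (d - 1) g) \<and>
             (\<forall>x. f x = lf a x * g x + f (x - lf a x *s w))"
  using assms
proof (induction rule: form.induct)
  case (form_const c)
  then show ?case by (intro exI[of _ "\<lambda>x. 0"]) simp
next
  case (form_coord d f i)
  then obtain g where g: "if d = 0 then g = (\<lambda>x. 0) else form (d - 1) g"
    and f: "\<And>x. f x = lf a x * g x + f (x - lf a x *s w)" by blast
  have gi: "form d (\<lambda>x. x $ i * g x)"
  proof (cases d)
    case 0 with g show ?thesis by (simp add: form_0)
  next
    case (Suc d') with g show ?thesis by (simp add: form.form_coord)
  qed
  have "form d (\<lambda>x. f (x - lf a x *s w))"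
    (is "form d ?f")
  proof -
    \<comment> \<open>the induction hypothesis, solved for the value of \<open>f\<close> at the projected vector; rewriting with it as it stands would not terminate\<close>
    have "B = A + (-1) * C" if "A = C + B" for A B C :: 'k
      using that by simp
    from this[OF f] have "?f = (\<lambda>x. f x + (-1) * (lf a x * g x))" by (rule ext)
    moreover have "form d (\<lambda>x. lf a x * g x)"
      using g by (cases d) (auto simp: form_0 intro: form_lf)
    ultimately show ?thesis
      using form.form_add[OF form_coord.hyps form_smult[of d "\<lambda>x. lf a x * g x" "-1"]] by simp
  qed
  then have "form d (\<lambda>x. x $ i * g x + w $ i * f (x - lf a x *s w))"
    by (intro form_add gi form_smult)
  moreover have "x $ i * f x = lf a x * (x $ i * g x + w $ i * f (x - lf a x *s w))
      + (x - lf a x *s w) $ i * f (x - lf a x *s w)" for x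
    by (subst f[of x]) (simp add: algebra_simps)
  ultimately show ?case
    by (intro exI[of _ "\<lambda>x. x $ i * g x + w $ i * f (x - lf a x *s w)"]) simp
next
  case (form_add d f1 f2)
  then obtain g1 g2 where "if d = 0 then g1 = (\<lambda>x. 0) else form (d - 1) g1"
    "if d = 0 then g2 = (\<lambda>x. 0) else form (d - 1) g2"
    and *: "\<And>x. f1 x = lf a x * g1 x + f1 (x - lf a x *s w)" "\<And>x. f2 x = lf a x * g2 x + f2 (x - lf a x *s w)"
    by blast
  then have "if d = 0 then (\<lambda>x. g1 x + g2 x) = (\<lambda>x. 0) else form (d - 1) (\<lambda>x. g1 x + g2 x)"
    by (auto intro: form.form_add split: if_splits)
  moreover have "f1 x + f2 x = lf a x * (g1 x + g2 x) + (f1 (x - lf a x *s w) + f2 (x - lf a x *s w))" for x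
    by (subst *(1)[of x], subst *(2)[of x]) (simp add: algebra_simps)
  ultimately show ?case by blast
qed

lemma form_factor:
  assumes "form (Suc d) f" and a: "a \<noteq> 0" and "\<And>x. x \<in> hyperplane a \<Longrightarrow> f x = 0"
  shows "\<exists>g. form d g \<and> (\<forall>x. f x = lf a x * g x)"
proof -
  obtain w where w: "lf a w = 1" using ex_lf_eq_one[OF a] by blast
  obtain g where "form d g" "\<forall>x. f x = lf a x * g x + f (x - lf a x *s w)"
    using form_projection[OF assms(1), of a w] by auto
  moreover have "f (x - lf a x *s w) = 0" for x
    using w by (intro assms(3)) (simp add: hyperplane_def)
  ultimately show ?thesis by auto
qed

text \<open>
  The binary form of degree \<open>N\<close> whose dehomogenisation at \<open>s = 1\<close> is \<open>p\<close>. Its values at \<open>s = 0\<close>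
  show whether the degree of \<open>p\<close> is smaller than \<open>N\<close>.
\<close>

definition hpoly :: "nat \<Rightarrow> 'k::field poly \<Rightarrow> 'k \<Rightarrow> 'k \<Rightarrow> 'k" where
  "hpoly N p s t = (\<Sum>j\<le>N. coeff p j * s ^ (N - j) * t ^ j)"

lemma hpoly_0 [simp]: "hpoly N 0 s t = 0"
  by (simp add: hpoly_def)

lemma hpoly_add: "hpoly N (p + r) s t = hpoly N p s t + hpoly N r s t"
  by (simp add: hpoly_def sum.distrib algebra_simps)

lemma hpoly_monom: "j \<le> N \<Longrightarrow> hpoly N (monom c j) s t = c * s ^ (N - j) * t ^ j"
proof -
  assume "j \<le> N"
  have "hpoly N (monom c j) s t = (\<Sum>i\<le>N. if i = j then c * s ^ (N - j) * t ^ j else 0)"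
    unfolding hpoly_def by (rule sum.cong) auto
  then show ?thesis using \<open>j \<le> N\<close> by simp
qed

lemma hpoly_nonzero: "degree p \<le> N \<Longrightarrow> s \<noteq> 0 \<Longrightarrow> hpoly N p s t = s ^ N * poly p (t / s)"
proof -
  assume *: "degree p \<le> N" "s \<noteq> 0"
  have "poly p (t / s) = (\<Sum>j\<le>N. coeff p j * (t / s) ^ j)"
    unfolding poly_altdef using *(1) by (intro sum.mono_neutral_left) (auto simp: coeff_eq_0)
  moreover have "coeff p j * s ^ (N - j) * t ^ j = s ^ N * (coeff p j * (t / s) ^ j)" if "j \<le> N" for j
    using *(2) that by (simp add: power_divide power_diff)
  ultimately show ?thesis
    unfolding hpoly_def by (simp only: sum_distrib_left) (rule sum.cong[OF refl], simp only: atMost_iff)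
qed

lemma hpoly_zero_left: "hpoly N p 0 t = coeff p N * t ^ N"
proof -
  have "hpoly N p 0 t = (\<Sum>j\<le>N. if j = N then coeff p N * t ^ N else 0)"
    unfolding hpoly_def by (rule sum.cong) (auto simp: power_0_left)
  then show ?thesis by simp
qed

lemma coeff_pcompose_shift_top:
  assumes "degree (p :: 'k::field poly) \<le> N" shows "coeff (pcompose p [:c, 1:]) N = coeff p N"
proof (cases "degree p = N")
  case True
  then show ?thesis
    using lead_coeff_comp[of "[:c, 1:]" p] degree_pcompose[of p "[:c, 1:]"] by simp
next
  case False
  then show ?thesis using assms degree_pcompose[of p "[:c, 1:]"] by (simp add: coeff_eq_0)
qed

text \<open>
  The substitution \<open>t \<mapsto> s c + t\<close> in the binary form is the translation of \<open>p\<close> by \<open>c\<close>.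
\<close>

lemma hpoly_shift:
  assumes "degree p \<le> N"
  shows "hpoly N p s (s * c + t) = hpoly N (pcompose p [:c, 1:]) s t"
proof (cases "s = 0")
  case True
  then show ?thesis using coeff_pcompose_shift_top[OF assms] by (simp add: hpoly_zero_left)
next
  case False
  have "degree (pcompose p [:c, 1:]) \<le> N" using assms degree_pcompose[of p "[:c, 1:]"] by simp
  then show ?thesis using False assms by (simp add: hpoly_nonzero poly_pcompose add_divide_distrib)
qed

section \<open>A form along a line\<close>

text \<open>
  Exponents of the monomials of degree at most \<open>d\<close> in the two coordinates transversal to a line.
\<close>

definition mons :: "nat \<Rightarrow> (nat \<times> nat) set" where
  "mons d = {(k, l). k + l \<le> d}"

lemma finite_mons [simp]: "finite (mons d)"
  by (rule finite_subset[of _ "{..d} \<times> {..d}"]) (auto simp: mons_def)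

lemma form_monomial_list:
  fixes f :: "'k::field ^ 'n::finite \<Rightarrow> 'k"
  assumes "form d f"
  shows "\<exists>ms. (\<forall>(c, i, j, k, l)\<in>set ms. i + j + k + l = d) \<and>
     (\<forall>s t y z. f (s *s p0 + t *s p1 + y *s e1 + z *s e2) =
        (\<Sum>(c, i, j, k, l)\<leftarrow>ms. c * s ^ i * t ^ j * y ^ k * z ^ l))"
  using assms
proof (induction rule: form.induct)
  case (form_const c)
  show ?case by (rule exI[of _ "[(c, 0, 0, 0, 0)]"]) simp
next
  case (form_coord d f n)
  then obtain ms where ms: "\<forall>(c, i, j, k, l)\<in>set ms. i + j + k + l = d"
    and f: "\<And>s t y z. f (s *s p0 + t *s p1 + y *s e1 + z *s e2) =
        (\<Sum>(c, i, j, k, l)\<leftarrow>ms. c * s ^ i * t ^ j * y ^ k * z ^ l)" by blast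
  let ?ms = "map (\<lambda>(c, i, j, k, l). (p0 $ n * c, Suc i, j, k, l)) ms @
    map (\<lambda>(c, i, j, k, l). (p1 $ n * c, i, Suc j, k, l)) ms @
    map (\<lambda>(c, i, j, k, l). (e1 $ n * c, i, j, Suc k, l)) ms @
    map (\<lambda>(c, i, j, k, l). (e2 $ n * c, i, j, k, Suc l)) ms"
  have "(s * p0 $ n + t * p1 $ n + y * e1 $ n + z * e2 $ n) *
        (\<Sum>(c, i, j, k, l)\<leftarrow>ms. c * s ^ i * t ^ j * y ^ k * z ^ l)
      = (\<Sum>(c, i, j, k, l)\<leftarrow>?ms. c * s ^ i * t ^ j * y ^ k * z ^ l)" for s t y z
    by (induction ms) (auto simp: algebra_simps)
  then have "(s *s p0 + t *s p1 + y *s e1 + z *s e2) $ n * f (s *s p0 + t *s p1 + y *s e1 + z *s e2)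
      = (\<Sum>(c, i, j, k, l)\<leftarrow>?ms. c * s ^ i * t ^ j * y ^ k * z ^ l)" for s t y z
    by (subst f) simp
  moreover have "\<forall>(c, i, j, k, l)\<in>set ?ms. i + j + k + l = Suc d" using ms by auto
  ultimately show ?case by blast
next
  case (form_add d f g)
  then obtain ms ms' where "\<forall>(c, i, j, k, l)\<in>set ms. i + j + k + l = d"
    "\<forall>(c, i, j, k, l)\<in>set ms'. i + j + k + l = d"
    and "\<And>s t y z. f (s *s p0 + t *s p1 + y *s e1 + z *s e2) =
        (\<Sum>(c, i, j, k, l)\<leftarrow>ms. c * s ^ i * t ^ j * y ^ k * z ^ l)"
    "\<And>s t y z. g (s *s p0 + t *s p1 + y *s e1 + z *s e2) =
        (\<Sum>(c, i, j, k, l)\<leftarrow>ms'. c * s ^ i * t ^ j * y ^ k * z ^ l)"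
    by blast
  then show ?case by (intro exI[of _ "ms @ ms'"]) auto
qed

text \<open>
  The Taylor expansion of a form along the line spanned by \<open>p0\<close> and \<open>p1\<close>: its coefficients are binary
  forms on the line. They are recorded as polynomials in one variable, because multiplicities of
  their zeros will be counted. The polynomials with \<open>k + l > d\<close> do not occur in the expansion.
\<close>

lemma form_along_line:
  fixes f :: "'k::field ^ 'n::finite \<Rightarrow> 'k"
  assumes "form d f"
  shows "\<exists>\<phi>. (\<forall>k l. degree (\<phi> k l) \<le> d - k - l) \<and>
     (\<forall>s t y z. f (s *s p0 + t *s p1 + y *s e1 + z *s e2) =
        (\<Sum>(k, l)\<in>mons d. y ^ k * z ^ l * hpoly (d - k - l) (\<phi> k l) s t))"
proof -
  obtain ms where ms: "\<forall>(c, i, j, k, l)\<in>set ms. i + j + k + l = d"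
    and f: "\<And>s t y z. f (s *s p0 + t *s p1 + y *s e1 + z *s e2) =
        (\<Sum>(c, i, j, k, l)\<leftarrow>ms. c * s ^ i * t ^ j * y ^ k * z ^ l)"
    using form_monomial_list[OF assms, of p0 p1 e1 e2] by blast
  from ms have "\<exists>\<phi>. (\<forall>k l. degree (\<phi> k l) \<le> d - k - l) \<and>
     (\<forall>s t y z. (\<Sum>(c, i, j, k, l)\<leftarrow>ms. c * s ^ i * t ^ j * y ^ k * z ^ l) =
        (\<Sum>(k, l)\<in>mons d. y ^ k * z ^ l * hpoly (d - k - l) (\<phi> k l) s t))"
  proof (induction ms)
    case Nil
    show ?case by (rule exI[of _ "\<lambda>k l. 0"]) (simp add: case_prod_beta)
  next
    case (Cons x ms)
    obtain c i j k l where x: "x = (c, i, j, k, l)" by (cases x) auto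
    obtain \<phi> where deg: "\<And>k l. degree (\<phi> k l) \<le> d - k - l" and eq: "\<And>s t y z.
       (\<Sum>(c, i, j, k, l)\<leftarrow>ms. c * s ^ i * t ^ j * y ^ k * z ^ l) =
        (\<Sum>(k, l)\<in>mons d. y ^ k * z ^ l * hpoly (d - k - l) (\<phi> k l) s t)"
      using Cons by auto
    have d: "i + j + k + l = d" using Cons.prems x by simp
    define \<psi> where "\<psi> k' l' = \<phi> k' l' + (if (k', l') = (k, l) then monom c j else 0)" for k' l'
    have "degree (\<psi> k' l') \<le> d - k' - l'" for k' l'
      unfolding \<psi>_def using deg[of k' l'] d
      by (intro degree_add_le) (auto intro: order.trans[OF degree_monom_le])
    moreover have "(\<Sum>(c, i, j, k, l)\<leftarrow>x # ms. c * s ^ i * t ^ j * y ^ k * z ^ l) =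
        (\<Sum>(k, l)\<in>mons d. y ^ k * z ^ l * hpoly (d - k - l) (\<psi> k l) s t)" for s t y z
    proof -
      have kl: "(k, l) \<in> mons d" using d by (simp add: mons_def)
      have "(\<Sum>(k, l)\<in>mons d. y ^ k * z ^ l * hpoly (d - k - l) (\<psi> k l) s t) =
        (\<Sum>kl'\<in>mons d. (case kl' of (k', l') \<Rightarrow> y ^ k' * z ^ l' * hpoly (d - k' - l') (\<phi> k' l') s t) +
           (if kl' = (k, l) then y ^ k * z ^ l * hpoly (d - k - l) (monom c j) s t else 0))"
      proof (rule sum.cong[OF refl])
        fix kl' :: "nat \<times> nat"
        obtain k' l' where "kl' = (k', l')" by (cases kl')
        then show "(case kl' of (k, l) \<Rightarrow> y ^ k * z ^ l * hpoly (d - k - l) (\<psi> k l) s t) =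
            (case kl' of (k', l') \<Rightarrow> y ^ k' * z ^ l' * hpoly (d - k' - l') (\<phi> k' l') s t) +
            (if kl' = (k, l) then y ^ k * z ^ l * hpoly (d - k - l) (monom c j) s t else 0)"
          by (cases "kl' = (k, l)") (auto simp: \<psi>_def hpoly_add distrib_left)
      qed
      also have "\<dots> = (\<Sum>(c, i, j, k, l)\<leftarrow>ms. c * s ^ i * t ^ j * y ^ k * z ^ l) +
           y ^ k * z ^ l * hpoly (d - k - l) (monom c j) s t"
        using kl by (simp add: sum.distrib eq)
      also have "hpoly (d - k - l) (monom c j) s t = c * s ^ (d - k - l - j) * t ^ j"
        by (rule hpoly_monom) (use d in simp)
      also have "d - k - l - j = i" using d by simp
      finally show ?thesis by (simp add: x algebra_simps)
    qed
    ultimately show ?case by blast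
  qed
  then show ?thesis using f by simp
qed

lemma sum_mons_zero: "(\<Sum>(k, l)\<in>mons d. 0 ^ k * 0 ^ l * G k l) = (G 0 0 :: 'k::field)"
proof -
  have "(\<Sum>(k, l)\<in>mons d. 0 ^ k * 0 ^ l * G k l) = (\<Sum>kl\<in>mons d. if kl = (0, 0) then G 0 0 else 0)"
    by (rule sum.cong) (auto simp: power_0_left split: if_splits)
  moreover have "(0, 0) \<in> mons d" by (simp add: mons_def)
  ultimately show ?thesis by simp
qed

lemma form_line_hpoly:
  fixes f :: "'k::field ^ 'n::finite \<Rightarrow> 'k"
  assumes "form d f"
  shows "\<exists>p. degree p \<le> d \<and> (\<forall>s t. f (s *s v + t *s u) = hpoly d p s t)"
proof -
  obtain \<phi> where deg: "\<And>k l. degree (\<phi> k l) \<le> d - k - l" and eq: "\<And>s t y z.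
      f (s *s v + t *s u + y *s 0 + z *s 0) =
        (\<Sum>(k, l)\<in>mons d. y ^ k * z ^ l * hpoly (d - k - l) (\<phi> k l) s t)"
    using form_along_line[OF assms, of v u 0 0] by blast
  have "f (s *s v + t *s u) = hpoly d (\<phi> 0 0) s t" for s t
    using eq[of s t 0 0] unfolding sum_mons_zero by simp
  then show ?thesis using deg[of 0 0] by auto
qed

lemma form_line_poly:
  fixes f :: "'k::field ^ 'n::finite \<Rightarrow> 'k"
  assumes "form d f" shows "\<exists>p. degree p \<le> d \<and> (\<forall>t. f (v + t *s u) = poly p t)"
proof -
  obtain p where p: "degree p \<le> d" "\<And>s t. f (s *s v + t *s u) = hpoly d p s t"
    using form_line_hpoly[OF assms] by metis
  have "f (v + t *s u) = poly p t" for t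
    using p(2)[of 1 t] hpoly_nonzero[OF p(1), of 1 t] by simp
  then show ?thesis using p(1) by blast
qed

section \<open>Zeros in the planes through a line\<close>

lemma poly_zero_on_field:
  fixes p :: "'k::{field, finite} poly"
  assumes "degree p < CARD('k)" "\<And>x. poly p x = 0"
  shows "p = 0"
proof (rule ccontr)
  assume "p \<noteq> 0"
  then have "card {x. poly p x = 0} \<le> degree p" by (rule card_poly_roots_bound)
  then show False using assms by simp
qed

text \<open>
  Consider a plane curve of degree \<open>m\<close>, in affine coordinates \<open>a\<close>, \<open>b\<close>, and the lines \<open>b = const\<close> for
  at most \<open>q\<close> values of \<open>b\<close>. A line inside the curve is a common root of all coefficients \<open>r i\<close> of the
  powers of \<open>a\<close>. As \<open>r i\<close> has degree at most \<open>m - i\<close>, the presence of \<open>k\<close> such lines kills \<open>r i\<close> for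
  \<open>i > m - k\<close>. Thus the degree in \<open>a\<close> drops to \<open>m - k\<close>, and each remaining line carries at most
  \<open>m - k\<close> points. In the estimate at the end \<open>q (m - k) + k q\<^sup>2\<close> is rewritten as
  \<open>m q + k (q\<^sup>2 - q)\<close>.
\<close>

lemma curve_on_parallel_lines:
  fixes r :: "nat \<Rightarrow> 'k::{field, finite} poly" and B :: "'k set" and m q :: nat
  defines "G \<equiv> \<lambda>a b. \<Sum>i\<le>m. a ^ i * poly (r i) b"
  defines "Z \<equiv> {b \<in> B. \<forall>a. G a b = 0}"
  assumes card: "CARD('k) = q\<^sup>2" and "m < q\<^sup>2" and B: "card B \<le> q"
    and deg: "\<forall>i. r i \<noteq> 0 \<longrightarrow> i + degree (r i) \<le> m"
    and nz: "\<exists>a b. G a b \<noteq> 0"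
  shows "card Z \<le> m" and "\<And>i. i > m - card Z \<Longrightarrow> r i = 0"
    and "card {(a, b). b \<in> B \<and> G a b = 0} \<le> m * q + card Z * (q\<^sup>2 - q)"
proof -
  define P where "P b = (\<Sum>i\<le>m. monom (poly (r i) b) i)" for b
  have G: "G a b = poly (P b) a" for a b
    by (simp add: G_def P_def poly_sum poly_monom mult.commute)
  have coeff: "coeff (P b) i = (if i \<le> m then poly (r i) b else 0)" for b i
    by (simp add: P_def coeff_sum)
  have degP: "degree (P b) \<le> m" for b
    by (rule degree_le) (simp add: coeff)
  have root: "poly (r i) b = 0" if "b \<in> Z" for i b
  proof (cases "i \<le> m")
    case True
    have "P b = 0" using that degP[of b] \<open>m < q\<^sup>2\<close>
      by (intro poly_zero_on_field) (auto simp: Z_def G card)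
    with coeff[of b i] True show ?thesis by simp
  next
    case False
    then show ?thesis using deg[rule_format, of i] by (cases "r i = 0") auto
  qed
  have *: "i + card Z \<le> m" if "r i \<noteq> 0" for i
  proof -
    have "card Z \<le> card {b. poly (r i) b = 0}"
      using root by (intro card_mono) auto
    also have "\<dots> \<le> degree (r i)" using that by (rule card_poly_roots_bound)
    finally show ?thesis using deg that by fastforce
  qed
  obtain a b where "G a b \<noteq> 0" using nz by blast
  then obtain i where "r i \<noteq> 0" unfolding G_def by (metis (no_types, lifting) mult_zero_right poly_0 sum.neutral)
  then show Zm: "card Z \<le> m" using * by fastforce
  show Z0: "r i = 0" if "i > m - card Z" for i using *[of i] that by fastforce
  have fB: "finite B" by simp
  have "Z \<subseteq> B" by (auto simp: Z_def)
  have lines: "card {a. G a b = 0} \<le> m - card Z" if "b \<in> B - Z" for b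
  proof -
    have "P b \<noteq> 0" using that by (auto simp: Z_def G)
    then have "card {a. poly (P b) a = 0} \<le> degree (P b)" by (rule card_poly_roots_bound)
    moreover have "degree (P b) \<le> m - card Z"
      by (rule degree_le) (auto simp: coeff Z0)
    ultimately show ?thesis by (simp add: G)
  qed
  have "{(a, b). b \<in> B \<and> G a b = 0} = (\<lambda>(b, a). (a, b)) ` (SIGMA b:B. {a. G a b = 0})"
    by auto
  then have "card {(a, b). b \<in> B \<and> G a b = 0} = card (SIGMA b:B. {a. G a b = 0})"
    by (simp add: card_image inj_on_def case_prod_beta prod_eq_iff)
  also have "\<dots> = (\<Sum>b\<in>B. card {a. G a b = 0})" by (simp add: card_SigmaI)
  also have "\<dots> = (\<Sum>b\<in>B - Z. card {a. G a b = 0}) + (\<Sum>b\<in>Z. card {a. G a b = 0})"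
    using \<open>Z \<subseteq> B\<close> fB by (rule sum.subset_diff)
  also have "(\<Sum>b\<in>B - Z. card {a. G a b = 0}) \<le> card (B - Z) * (m - card Z)"
    using lines sum_bounded_above[of "B - Z" "\<lambda>b. card {a. G a b = 0}" "m - card Z"] by simp
  also have "(\<Sum>b\<in>Z. card {a. G a b = 0}) \<le> card Z * q\<^sup>2"
  proof -
    have "card {a. G a b = 0} \<le> q\<^sup>2" for b
      using card_mono[of UNIV "{a. G a b = 0}"] card by simp
    then show ?thesis using sum_bounded_above[of Z "\<lambda>b. card {a. G a b = 0}" "q\<^sup>2"] by simp
  qed
  finally have "card {(a, b). b \<in> B \<and> G a b = 0} \<le> card (B - Z) * (m - card Z) + card Z * q\<^sup>2"
    by simp
  also have "card (B - Z) * (m - card Z) \<le> q * (m - card Z)"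
    using B \<open>Z \<subseteq> B\<close> by (intro mult_le_mono) (auto simp: card_Diff_subset)
  also have "q * (m - card Z) + card Z * q\<^sup>2 = m * q + card Z * (q\<^sup>2 - q)"
  proof -
    have "card Z * q \<le> q * m" "card Z * q \<le> card Z * q\<^sup>2"
      using Zm by (simp_all add: power2_eq_square)
    then show ?thesis by (simp add: diff_mult_distrib2 algebra_simps)
  qed
  finally show "card {(a, b). b \<in> B \<and> G a b = 0} \<le> m * q + card Z * (q\<^sup>2 - q)" by simp
qed

text \<open>
  The same count for a curve given as the section of a form by a plane through the line, in which
  \<open>e\<close> copies of the line have been removed: \<open>g k l i\<close> comes from the terms of degree \<open>k + l\<close>
  transversal to the line, so the curve has degree \<open>d - e\<close>. The part that matters later is the second
  claim: lines inside the curve annihilate leading coefficients of the part of degree \<open>e\<close>.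
\<close>

lemma section_bound:
  fixes g :: "nat \<Rightarrow> nat \<Rightarrow> nat \<Rightarrow> 'k::{field, finite}" and B :: "'k set" and d e q :: nat
  defines "S \<equiv> \<lambda>a b. \<Sum>(k, l)\<in>mons d. \<Sum>i\<le>d - k - l. g k l i * a ^ i * b ^ (d - k - l - i)"
  defines "Z \<equiv> {b \<in> B. \<forall>a. S a b = 0}"
  assumes card: "CARD('k) = q\<^sup>2" and "d < q\<^sup>2" and "e \<le> d" and B: "card B \<le> q"
    and low: "\<forall>k l i. k + l < e \<longrightarrow> g k l i = 0"
    and nz: "\<exists>a b. S a b \<noteq> 0"
  shows "card Z \<le> d - e"
    and "\<And>i. d - e - card Z < i \<Longrightarrow> i \<le> d - e \<Longrightarrow> (\<Sum>(k, l)\<in>{(k, l). k + l = e}. g k l i) = 0"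
    and "card {(a, b). b \<in> B \<and> S a b = 0} \<le> (d - e) * q + card Z * (q\<^sup>2 - q)"
proof -
  define m where "m = d - e"
  define R where "R i = (\<Sum>(k, l)\<in>mons d. if k + l + i \<le> d then monom (g k l i) (d - k - l - i) else 0)" for i
  have coeff_R: "coeff (R i) n = (\<Sum>(k, l)\<in>mons d. if k + l + i + n = d then g k l i else 0)" for i n
    unfolding R_def coeff_sum by (rule sum.cong) (auto simp: mons_def)
  have coeff_R_0: "coeff (R i) n = 0" if "m < i + n" for i n
    unfolding coeff_R by (rule sum.neutral) (use that low in \<open>auto simp: m_def\<close>)
  have deg: "\<forall>i. R i \<noteq> 0 \<longrightarrow> i + degree (R i) \<le> m"
    using coeff_R_0 by (metis leading_coeff_0_iff not_le)
  have R0: "R i = 0" if "i > m" for i using deg that by (metis add_leD1 not_le)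
  have S: "S a b = (\<Sum>i\<le>m. a ^ i * poly (R i) b)" for a b
  proof -
    have "(\<Sum>i\<le>m. a ^ i * poly (R i) b) = (\<Sum>i\<le>d. a ^ i * poly (R i) b)"
      by (rule sum.mono_neutral_left) (auto simp: m_def R0)
    also have "\<dots> = (\<Sum>i\<le>d. \<Sum>(k, l)\<in>mons d. if k + l + i \<le> d then g k l i * a ^ i * b ^ (d - k - l - i) else 0)"
      unfolding R_def poly_sum sum_distrib_left
      by (intro sum.cong refl) (auto simp: poly_monom algebra_simps)
    also have "\<dots> = (\<Sum>(k, l)\<in>mons d. \<Sum>i\<le>d. if k + l + i \<le> d then g k l i * a ^ i * b ^ (d - k - l - i) else 0)"
      by (subst sum.swap) (simp add: case_prod_beta)
    also have "\<dots> = S a b"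
      unfolding S_def
    proof (intro sum.cong refl, clarify)
      fix k l assume "(k, l) \<in> mons d"
      show "(\<Sum>i\<le>d. if k + l + i \<le> d then g k l i * a ^ i * b ^ (d - k - l - i) else 0) =
          (\<Sum>i\<le>d - k - l. g k l i * a ^ i * b ^ (d - k - l - i))"
        by (rule sum.mono_neutral_cong_right) (use \<open>(k, l) \<in> mons d\<close> in \<open>auto simp: mons_def\<close>)
    qed
    finally show ?thesis by simp
  qed
  have Z: "Z = {b \<in> B. \<forall>a. (\<Sum>i\<le>m. a ^ i * poly (R i) b) = 0}" by (simp add: Z_def S)
  have "m < q\<^sup>2" "\<exists>a b. (\<Sum>i\<le>m. a ^ i * poly (R i) b) \<noteq> 0"
    using \<open>d < q\<^sup>2\<close> nz by (auto simp: m_def S)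
  note curve = curve_on_parallel_lines[OF card this(1) B deg this(2), folded Z]
  show "card Z \<le> d - e" using curve(1) by (simp add: m_def)
  show "card {(a, b). b \<in> B \<and> S a b = 0} \<le> (d - e) * q + card Z * (q\<^sup>2 - q)"
    using curve(3) by (simp add: m_def S)
  show "(\<Sum>(k, l)\<in>{(k, l). k + l = e}. g k l i) = 0" if "d - e - card Z < i" "i \<le> d - e" for i
  proof -
    have "R i = 0" using that curve(2)[of i] unfolding m_def by blast
    then have "0 = coeff (R i) (m - i)" by simp
    also have "\<dots> = (\<Sum>(k, l)\<in>{(k, l). k + l = e}. g k l i)"
    proof -
      have "k + l + i + (m - i) = d \<longleftrightarrow> k + l = e" for k l
        using that \<open>e \<le> d\<close> by (auto simp: m_def)
      then have "coeff (R i) (m - i) = (\<Sum>(k, l)\<in>mons d. if k + l = e then g k l i else 0)"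
        unfolding coeff_R by simp
      also have "\<dots> = (\<Sum>(k, l)\<in>{(k, l). k + l = e}. g k l i)"
      proof (rule sum.mono_neutral_cong_right)
        show "{(k, l). k + l = e} \<subseteq> mons d" using \<open>e \<le> d\<close> by (auto simp: mons_def)
      qed (simp_all add: case_prod_beta)
      finally show ?thesis .
    qed
    finally show ?thesis by simp
  qed
qed

lemma finite_pairs_sum [simp]: "finite {(k, l). k + l = (e :: nat)}"
  by (rule finite_subset[of _ "{..e} \<times> {..e}"]) auto

text \<open>
  The expansion along a line of a form of degree \<open>d\<close> that vanishes on the line with multiplicity
  exactly \<open>e \<ge> 1\<close>. The bound \<open>d \<le> q\<close> makes \<open>d - e\<close> smaller than \<open>q\<close>.
\<close>

locale pencil =
  fixes q d e :: nat and \<phi> :: "nat \<Rightarrow> nat \<Rightarrow> 'k::{field, finite} poly"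
  assumes card_field: "CARD('k) = q\<^sup>2" and char: "\<exists>n. q = CHAR('k) ^ n"
    and e: "1 \<le> e" "e \<le> d" "d \<le> q"
    and deg: "degree (\<phi> k l) \<le> d - k - l"
    and low: "k + l < e \<Longrightarrow> \<phi> k l = 0"
    and top: "\<exists>k l. k + l = e \<and> \<phi> k l \<noteq> 0"
begin

text \<open>
  The leading part of the expansion, evaluated in the direction \<open>(T\<^sup>q, -1)\<close> of the tangent plane at
  the point with parameter \<open>T\<close>. It measures the contact of the zero set with the Hermitian surface
  along the line. In \<open>contact_at t\<close> the direction is frozen at the parameter \<open>t\<close>.
\<close>

definition contact :: "'k poly" where
  "contact = (\<Sum>(k, l)\<in>{(k, l). k + l = e}. smult ((-1) ^ l) (monom 1 (q * k) * \<phi> k l))"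

definition contact_at :: "'k \<Rightarrow> 'k poly" where
  "contact_at t = (\<Sum>(k, l)\<in>{(k, l). k + l = e}. smult ((-1) ^ l * t ^ (q * k)) (\<phi> k l))"

lemma q_gt_1: "q > 1"
proof -
  have "card {0, 1 :: 'k} \<le> CARD('k)" by (intro card_mono) auto
  then show ?thesis using card_field by (cases "q \<le> 1") (auto simp: le_Suc_eq)
qed

text \<open>
  In characteristic \<open>p\<close> with \<open>q\<close> a power of \<open>p\<close>, \<open>T\<^sup>q - t\<^sup>q = (T - t)\<^sup>q\<close>, and \<open>x - y\<close> divides
  \<open>x\<^sup>k - y\<^sup>k\<close>.
\<close>

lemma dvd_frobenius: "[:- t, 1:] ^ q dvd monom (1 :: 'k) (q * k) - [:t ^ (q * k):]"
proof -
  obtain n where n: "q = CHAR('k) ^ n" using char by blast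
  have "CHAR('k) > 0" by (rule finite_imp_CHAR_pos) simp
  then have prime: "prime CHAR('k poly)" using prime_CHAR_semidom by simp
  have add: "(x + y) ^ q = x ^ q + y ^ q" for x y :: "'k poly"
    by (rule freshmans_dream'[OF prime, of _ n]) (simp add: n)
  have minus: "(- x) ^ q = - (x ^ q)" for x :: "'k poly"
  proof -
    have "x ^ q + (- x) ^ q = (x + - x) ^ q" by (simp only: add)
    also have "\<dots> = 0" using q_gt_1 by (simp add: zero_power)
    finally have "x ^ q + (- x) ^ q = 0" .
    then show ?thesis by (metis add_eq_0_iff)
  qed
  have "[:- t, 1:] = monom 1 1 + (- [:t:])" by (simp add: monom_altdef)
  then have "[:- t, 1:] ^ q = monom 1 q - [:t:] ^ q"
    using minus[of "[:t:]"] add[of "monom 1 1" "[:- t:]"] by (simp add: monom_power)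
  moreover have "monom (1 :: 'k) (q * k) = monom 1 q ^ k" by (simp add: monom_power mult.commute)
  moreover have "[:t ^ (q * k):] = ([:t:] ^ q) ^ k" by (simp add: poly_const_pow power_mult)
  moreover have "monom 1 q - [:t:] ^ q dvd monom 1 q ^ k - ([:t:] ^ q) ^ k"
    unfolding power_diff_sumr2 by (rule dvd_triv_left)
  ultimately show ?thesis by (simp only:)
qed

text \<open>
  The tangent direction is constant to order \<open>q\<close>, so up to that order it can be frozen.
\<close>

lemma dvd_contact:
  assumes "n \<le> q" "[:- t, 1:] ^ n dvd contact_at t"
  shows "[:- t, 1:] ^ n dvd contact"
proof -
  have "contact - contact_at t = (\<Sum>(k, l)\<in>{(k, l). k + l = e}.
      (monom 1 (q * k) - [:t ^ (q * k):]) * smult ((-1) ^ l) (\<phi> k l))"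
    unfolding contact_def contact_at_def sum_subtractf[symmetric]
    by (rule sum.cong) (auto simp: algebra_simps smult_diff_right)
  also have "[:- t, 1:] ^ q dvd \<dots>"
    by (rule dvd_sum) (auto intro: dvd_smult dvd_mult2 dvd_frobenius)
  finally have "[:- t, 1:] ^ n dvd contact - contact_at t"
    using assms(1) by (meson dvd_trans le_imp_power_dvd)
  then have "[:- t, 1:] ^ n dvd contact - contact_at t + contact_at t"
    using assms(2) by (rule dvd_add)
  then show ?thesis unfolding diff_add_cancel .
qed

lemma degree_lt_q: "k + l = e \<Longrightarrow> degree (\<phi> k l) < q"
proof -
  assume "k + l = e"
  then have "d - k - l < q" using e by simp
  then show ?thesis using deg[of k l] by simp
qed

text \<open>
  The factors \<open>T\<^bsup>q k\<^esup>\<close> separate the summands, whose coefficients have degree less than \<open>q\<close>.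
\<close>

lemma contact_nonzero: "contact \<noteq> 0"
proof -
  obtain k0 l0 where kl: "k0 + l0 = e" "\<phi> k0 l0 \<noteq> 0" using top by blast
  define N where "N = q * k0 + degree (\<phi> k0 l0)"
  have "coeff contact N = (\<Sum>(k, l)\<in>{(k, l). k + l = e}.
      if (k, l) = (k0, l0) then (-1) ^ l0 * lead_coeff (\<phi> k0 l0) else 0)"
    unfolding contact_def coeff_sum
  proof (intro sum.cong refl, clarify)
    fix k l assume e': "e = k + l"
    show "coeff (smult ((-1) ^ l) (monom 1 (q * k) * \<phi> k l)) N =
        (if (k, l) = (k0, l0) then (-1) ^ l0 * lead_coeff (\<phi> k0 l0) else 0)"
    proof (cases k k0 rule: linorder_cases)
      case less
      then have "q * (k + 1) \<le> q * k0" by (intro mult_le_mono) auto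
      then have "degree (\<phi> k l) < N - q * k"
        using degree_lt_q[of k l] e' by (simp add: N_def)
      then show ?thesis using less by (simp add: coeff_monom_mult coeff_eq_0)
    next
      case equal
      then show ?thesis using e' kl by (simp add: coeff_monom_mult N_def)
    next
      case greater
      then have "q * (k0 + 1) \<le> q * k" by (intro mult_le_mono) auto
      then have "N < q * k" using degree_lt_q[OF kl(1)] by (simp add: N_def)
      then show ?thesis using greater by (simp add: coeff_monom_mult)
    qed
  qed
  also have "\<dots> = (\<Sum>x\<in>{(k, l). k + l = e}. if x = (k0, l0) then (-1) ^ l0 * lead_coeff (\<phi> k0 l0) else 0)"
    by (rule sum.cong[OF refl]) (simp only: case_prod_beta prod.collapse)
  also have "\<dots> = (-1) ^ l0 * lead_coeff (\<phi> k0 l0)" using kl by simp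
  also have "\<dots> \<noteq> 0" using kl by simp
  finally show ?thesis by auto
qed

lemma degree_contact:
  assumes "degree (\<phi> e 0) \<le> n"
  shows "degree contact \<le> q * e + n"
  unfolding contact_def
proof (rule degree_sum_le, simp, clarify)
  fix k l assume e': "e = k + l"
  have "degree (smult ((-1) ^ l) (monom 1 (q * k) * \<phi> k l)) \<le> q * k + degree (\<phi> k l)"
    by (rule order.trans[OF degree_smult_le], rule order.trans[OF degree_mult_le])
       (simp add: degree_monom_le)
  also have "\<dots> \<le> q * (k + l) + n"
  proof (cases l)
    case 0
    then show ?thesis using assms e' by simp
  next
    case (Suc l')
    then show ?thesis using degree_lt_q[of k l] e' by (simp add: algebra_simps)
  qed
  finally show "degree (smult ((-1) ^ l) (monom 1 (q * k) * \<phi> k l)) \<le> q * (k + l) + n" .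
qed

text \<open>
  The values of the form in the tangent plane at the point \<open>p0 + t p1\<close>, in affine coordinates for
  which \<open>b\<close> labels the lines through that point.
\<close>

definition section_at :: "'k \<Rightarrow> 'k \<Rightarrow> 'k \<Rightarrow> 'k" where
  "section_at t a b = (\<Sum>(k, l)\<in>mons d. (t ^ q) ^ k * (-1) ^ l * hpoly (d - k - l) (\<phi> k l) a (a * t + b))"

definition section_inf :: "'k \<Rightarrow> 'k \<Rightarrow> 'k" where
  "section_inf a b = (\<Sum>(k, l)\<in>mons d. 0 ^ l * hpoly (d - k - l) (\<phi> k l) b a)"

lemma d_less: "d < q\<^sup>2"
proof -
  have "d \<le> q" by (rule e(3))
  also have "q = q * 1" by simp
  also have "q * 1 < q * q" using q_gt_1 by (intro mult_strict_left_mono) auto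
  finally show ?thesis by (simp only: power2_eq_square)
qed

text \<open>
  In the coordinates centred at \<open>t\<close>, the coefficients of \<open>contact_at t\<close> of index less than the number
  of lines are exactly the leading coefficients that these lines annihilate.
\<close>

lemma section_at_bound:
  assumes B: "card B \<le> q" and nz: "\<exists>a b. section_at t a b \<noteq> 0"
  shows "card {(a, b). b \<in> B \<and> section_at t a b = 0} \<le> (d - e) * q + order t contact * (q\<^sup>2 - q)"
proof -
  define p where "p k l = pcompose (\<phi> k l) [:t, 1:]" for k l
  define g where "g k l i = (t ^ q) ^ k * (-1) ^ l * coeff (p k l) (d - k - l - i)" for k l i
  define Z where "Z = {b \<in> B. \<forall>a. section_at t a b = 0}"
  have tr: "section_at t a b = (\<Sum>(k, l)\<in>mons d. \<Sum>i\<le>d - k - l. g k l i * a ^ i * b ^ (d - k - l - i))" for a b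
    unfolding section_at_def
  proof (intro sum.cong refl, clarify)
    fix k l
    have "(t ^ q) ^ k * (-1) ^ l * hpoly (d - k - l) (\<phi> k l) a (a * t + b) =
        (\<Sum>j\<le>d - k - l. (t ^ q) ^ k * (-1) ^ l * coeff (p k l) j * a ^ (d - k - l - j) * b ^ j)"
      unfolding hpoly_shift[OF deg] by (simp add: hpoly_def p_def sum_distrib_left algebra_simps)
    also have "\<dots> = (\<Sum>i\<le>d - k - l. g k l i * a ^ i * b ^ (d - k - l - i))"
      by (rule sum.reindex_bij_witness[of _ "\<lambda>i. d - k - l - i" "\<lambda>i. d - k - l - i"])
         (auto simp: g_def simp del: diff_diff_left)
    finally show "(t ^ q) ^ k * (-1) ^ l * hpoly (d - k - l) (\<phi> k l) a (a * t + b) =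
        (\<Sum>i\<le>d - k - l. g k l i * a ^ i * b ^ (d - k - l - i))" .
  qed
  have "\<forall>k l i. k + l < e \<longrightarrow> g k l i = 0" using low by (simp add: g_def p_def)
  note sb = section_bound[OF card_field d_less e(2) B this nz[unfolded tr], folded tr, folded Z_def]
  have cZ: "card Z \<le> d - e" by (rule sb(1))
  have shift: "pcompose (contact_at t) [:t, 1:] =
      (\<Sum>(k, l)\<in>{(k, l). k + l = e}. smult ((-1) ^ l * t ^ (q * k)) (p k l))"
    unfolding contact_at_def p_def pcompose_sum by (rule sum.cong) (auto simp: pcompose_smult)
  have "coeff (pcompose (contact_at t) [:t, 1:]) n = 0" if "n < card Z" for n
  proof -
    have "coeff (pcompose (contact_at t) [:t, 1:]) n = (\<Sum>(k, l)\<in>{(k, l). k + l = e}. g k l (d - e - n))"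
      unfolding shift coeff_sum
    proof (intro sum.cong refl, clarify)
      fix k l assume e': "e = k + l"
      have "d - k - l - (d - (k + l) - n) = n" using that cZ e' by simp
      then show "coeff (smult ((-1) ^ l * t ^ (q * k)) (p k l)) n = g k l (d - (k + l) - n)"
        by (simp add: g_def power_mult)
    qed
    also have "\<dots> = 0" using that cZ by (intro sb(2)) auto
    finally show ?thesis .
  qed
  then have "monom 1 (card Z) dvd pcompose (contact_at t) [:t, 1:]"
    by (simp add: monom_1_dvd_iff')
  then obtain h where h: "pcompose (contact_at t) [:t, 1:] = monom 1 (card Z) * h" by (elim dvdE)
  have "contact_at t = pcompose (pcompose (contact_at t) [:t, 1:]) [:- t, 1:]"
    by (simp add: pcompose_assoc[symmetric] pcompose_pCons pcompose_idR)
  also have "\<dots> = [:- t, 1:] ^ card Z * pcompose h [:- t, 1:]"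
  proof -
    have "pcompose (monom 1 n) [:- t, 1:] = [:- t, 1:] ^ n" for n
      by (induction n) (simp_all add: monom_0 monom_Suc pcompose_pCons one_pCons)
    then show ?thesis by (simp add: h pcompose_mult)
  qed
  finally have "[:- t, 1:] ^ card Z dvd contact_at t" by (metis dvd_triv_left)
  then have "[:- t, 1:] ^ card Z dvd contact" using cZ e by (intro dvd_contact) auto
  then have "card Z \<le> order t contact" using contact_nonzero by (simp add: order_divides)
  then have "card Z * (q\<^sup>2 - q) \<le> order t contact * (q\<^sup>2 - q)" by simp
  with sb(3) show ?thesis by linarith
qed

text \<open>
  At the point \<open>p1\<close>, which has no parameter, only the summand \<open>\<phi> e 0\<close> of \<open>contact\<close> is seen, and it
  alone can reach the degree \<open>q e + (d - e)\<close>.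
\<close>

lemma section_inf_bound:
  assumes B: "card B \<le> q" and nz: "\<exists>a b. section_inf a b \<noteq> 0"
  shows "\<exists>z \<le> d - e. card {(a, b). b \<in> B \<and> section_inf a b = 0} \<le> (d - e) * q + z * (q\<^sup>2 - q) \<and>
           degree contact \<le> q * e + (d - e - z)"
proof -
  define g where "g k l i = 0 ^ l * coeff (\<phi> k l) i" for k l i
  define Z where "Z = {b \<in> B. \<forall>a. section_inf a b = 0}"
  have tr: "section_inf a b = (\<Sum>(k, l)\<in>mons d. \<Sum>i\<le>d - k - l. g k l i * a ^ i * b ^ (d - k - l - i))" for a b
    unfolding section_inf_def hpoly_def sum_distrib_left
    by (intro sum.cong refl) (auto simp: g_def algebra_simps)
  have "\<forall>k l i. k + l < e \<longrightarrow> g k l i = 0" using low by (simp add: g_def)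
  note sb = section_bound[OF card_field d_less e(2) B this nz[unfolded tr], folded tr, folded Z_def]
  have "degree (\<phi> e 0) \<le> d - e - card Z"
  proof (rule degree_le, safe)
    fix i assume i: "d - e - card Z < i"
    show "coeff (\<phi> e 0) i = 0"
    proof (cases "i \<le> d - e")
      case True
      have "0 = (\<Sum>(k, l)\<in>{(k, l). k + l = e}. g k l i)" using sb(2)[OF i True] by simp
      also have "\<dots> = (\<Sum>x\<in>{(k, l). k + l = e}. if x = (e, 0) then coeff (\<phi> e 0) i else 0)"
        by (rule sum.cong) (auto simp: g_def)
      also have "\<dots> = coeff (\<phi> e 0) i" by simp
      finally show ?thesis by simp
    next
      case False
      then show ?thesis using deg[of e 0] by (intro coeff_eq_0) auto
    qed
  qed
  then have "degree contact \<le> q * e + (d - e - card Z)" by (rule degree_contact)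
  with sb(1,3) show ?thesis by blast
qed

text \<open>
  The zeros of \<open>contact\<close>, counted with multiplicity, and its defect in degree bound the total number
  of lines by \<open>q e + (d - e)\<close>. The resulting bound decreases in \<open>e\<close>, and the last step replaces \<open>e\<close>
  by 1. The summand \<open>q\<^sup>2\<close> on the left makes room for the points on the line itself.
\<close>

lemma pencil_count:
  assumes B: "\<And>t. card (B t) \<le> q" "card B' \<le> q"
    and nz: "\<And>t. \<exists>a b. section_at t a b \<noteq> 0" "\<exists>a b. section_inf a b \<noteq> 0"
  shows "(\<Sum>t\<in>UNIV. card {(a, b). b \<in> B t \<and> section_at t a b = 0}) +
      card {(a, b). b \<in> B' \<and> section_inf a b = 0} + q\<^sup>2 \<le> d * q ^ 3 + (d - 1) * q\<^sup>2"
proof -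
  obtain z where z: "z \<le> d - e" "card {(a, b). b \<in> B' \<and> section_inf a b = 0} \<le> (d - e) * q + z * (q\<^sup>2 - q)"
    and dc: "degree contact \<le> q * e + (d - e - z)" using section_inf_bound[OF B(2) nz(2)] by blast
  have "(\<Sum>t\<in>UNIV. order t contact) = (\<Sum>t\<in>set_mset (proots contact). count (proots contact) t)"
    using contact_nonzero by (intro sum.mono_neutral_cong_right) (auto simp: order_root)
  also have "\<dots> = size (proots contact)" by (simp add: size_multiset_overloaded_eq)
  also have "\<dots> \<le> degree contact" by (rule size_proots_le)
  finally have ord: "(\<Sum>t\<in>UNIV. order t contact) + z \<le> q * e + (d - e)" using dc z(1) by linarith
  have "(\<Sum>t\<in>UNIV. card {(a, b). b \<in> B t \<and> section_at t a b = 0})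
      \<le> (\<Sum>t\<in>UNIV. (d - e) * q + order t contact * (q\<^sup>2 - q))"
    by (intro sum_mono section_at_bound B nz)
  also have "\<dots> = q\<^sup>2 * ((d - e) * q) + (\<Sum>t\<in>UNIV. order t contact) * (q\<^sup>2 - q)"
    by (simp add: sum.distrib card_field sum_distrib_right)
  finally have sum_le: "(\<Sum>t\<in>UNIV. card {(a, b). b \<in> B t \<and> section_at t a b = 0})
      \<le> q\<^sup>2 * ((d - e) * q) + (\<Sum>t\<in>UNIV. order t contact) * (q\<^sup>2 - q)" .
  then have "(\<Sum>t\<in>UNIV. card {(a, b). b \<in> B t \<and> section_at t a b = 0}) +
      card {(a, b). b \<in> B' \<and> section_inf a b = 0}
      \<le> (q\<^sup>2 + 1) * ((d - e) * q) + ((\<Sum>t\<in>UNIV. order t contact) + z) * (q\<^sup>2 - q)"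
  proof -
    have "x + y \<le> (c + 1) * m + (n + z) * w" if "x \<le> c * m + n * w" "y \<le> m + z * w"
      for x y c m n w :: nat using that by (simp add: algebra_simps)
    from this[OF sum_le z(2)] show ?thesis .
  qed
  also have "\<dots> \<le> (q\<^sup>2 + 1) * ((d - e) * q) + (q * e + (d - e)) * (q\<^sup>2 - q)"
    using ord by (intro add_left_mono mult_le_mono1)
  finally have *: "(\<Sum>t\<in>UNIV. card {(a, b). b \<in> B t \<and> section_at t a b = 0}) +
      card {(a, b). b \<in> B' \<and> section_inf a b = 0}
      \<le> (q\<^sup>2 + 1) * ((d - e) * q) + (q * e + (d - e)) * (q\<^sup>2 - q)" .
  \<comment> \<open>substitutions that remove the subtractions from the numerical inequality\<close>
  obtain m where m: "d = e + m" using e(2) le_Suc_ex by blast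
  obtain e' where e': "e = Suc e'" using e(1) by (cases e) auto
  obtain u where u: "q = Suc u" using q_gt_1 by (cases q) auto
  have "q\<^sup>2 - q = q * u" by (simp add: u power2_eq_square)
  then have "(q\<^sup>2 + 1) * ((d - e) * q) + (q * e + (d - e)) * (q\<^sup>2 - q) + q\<^sup>2 \<le> d * q ^ 3 + (d - 1) * q\<^sup>2"
    by (simp add: m e' u power2_eq_square power3_eq_cube algebra_simps)
  with * show ?thesis by linarith
qed

end

section \<open>The Hermitian form\<close>

lemma power_card_field: "(x :: 'k::{field, finite}) ^ CARD('k) = x"
proof (cases "x = 0")
  case True
  then show ?thesis using zero_less_card_finite[where 'a='k] by (simp add: zero_power del: zero_less_card_finite)
next
  case False
  let ?U = "UNIV - {0 :: 'k}"
  have "bij_betw ((*) x) ?U ?U"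
    by (rule bij_betwI[of _ _ _ "\<lambda>y. y / x"]) (use False in auto)
  then have "(\<Prod>y\<in>?U. x * y) = (\<Prod>y\<in>?U. y)" by (rule prod.reindex_bij_betw)
  then have "x ^ card ?U * (\<Prod>y\<in>?U. y) = (\<Prod>y\<in>?U. y)" by (simp only: prod.distrib prod_constant)
  moreover have "(\<Prod>y\<in>?U. y) \<noteq> 0" by (subst prod_zero_iff) auto
  ultimately have "x ^ card ?U = 1" by simp
  moreover have "CARD('k) = Suc (card ?U)" by (simp add: card_Suc_Diff1)
  ultimately show ?thesis by (simp only: power_Suc mult_1_right)
qed

locale hermitian_surface =
  fixes q :: nat and A :: "'k::{field, finite} ^ 4 ^ 4"
  assumes primepow_q: "primepow q" and q3: "q \<ge> 3" and card_field: "CARD('k) = q\<^sup>2"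
    and nondeg: "nondeg_hermitian q A"
begin

lemma char: "\<exists>n. q = CHAR('k) ^ n"
proof -
  obtain p n where p: "prime p" "q = p ^ n" using primepow_q by (auto simp: primepow_def)
  have "CHAR('k) > 0" by (rule finite_imp_CHAR_pos) simp
  then have c: "prime CHAR('k)" by (rule prime_CHAR_semidom)
  have "CHAR('k) dvd p ^ (n * 2)"
    using CHAR_dvd_CARD[where 'a='k] p by (simp add: card_field power_mult)
  then have "CHAR('k) dvd p" using c prime_dvd_power by blast
  then have "CHAR('k) = p" using c p(1) primes_dvd_imp_eq by blast
  then show ?thesis using p(2) by blast
qed

lemma prime_char: "prime CHAR('k)"
  by (rule prime_CHAR_semidom) (rule finite_imp_CHAR_pos, simp)

lemma frob_add: "((x :: 'k) + y) ^ q = x ^ q + y ^ q"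
proof -
  obtain n where "q = CHAR('k) ^ n" using char by blast
  then show ?thesis by (rule freshmans_dream'[OF prime_char])
qed

lemma frob_sum: "(\<Sum>i\<in>I. f i :: 'k) ^ q = (\<Sum>i\<in>I. f i ^ q)"
proof -
  obtain n where "q = CHAR('k) ^ n" using char by blast
  then show ?thesis by (rule freshmans_dream_sum'[OF prime_char])
qed

lemma q_pos [simp]: "0 < q"
  using q3 by simp

lemma frob_0 [simp]: "(0 :: 'k) ^ q = 0"
  by (simp add: zero_power)

lemma frob_minus: "(- x :: 'k) ^ q = - (x ^ q)"
proof -
  have "x ^ q + (- x) ^ q = (x + - x) ^ q" by (simp only: frob_add)
  then have "x ^ q + (- x) ^ q = 0" by simp
  then show ?thesis by (metis add_eq_0_iff)
qed

lemma frob_frob [simp]: "((x :: 'k) ^ q) ^ q = x"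
  using power_card_field[of x] by (simp add: card_field power2_eq_square power_mult)

lemma of_nat_q: "of_nat q = (0 :: 'k)"
proof -
  obtain n where n: "q = CHAR('k) ^ n" using char by blast
  then have "n \<noteq> 0" using q3 by (cases n) auto
  then have "CHAR('k) dvd q" using n by (simp add: dvd_power)
  then show ?thesis using of_nat_eq_0_iff_char_dvd by blast
qed

text \<open>
  The coefficient vector of the tangent plane at \<open>y\<close>; it depends on \<open>y\<close> semilinearly.
\<close>

definition polar :: "'k ^ 4 \<Rightarrow> 'k ^ 4" where
  "polar y = (\<chi> i. \<Sum>j\<in>UNIV. A $ i $ j * (y $ j) ^ q)"

definition h :: "'k ^ 4 \<Rightarrow> 'k ^ 4 \<Rightarrow> 'k" where
  "h x y = lf (polar y) x"

lemma polar_add: "polar (x + y) = polar x + polar y"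
  by (simp add: polar_def vec_eq_iff frob_add sum.distrib algebra_simps)

lemma polar_scale: "polar (c *s x) = c ^ q *s polar x"
  by (simp add: polar_def vec_eq_iff power_mult_distrib sum_distrib_left algebra_simps)

lemma polar_0 [simp]: "polar 0 = 0"
  using polar_scale[of 0 0] by simp

lemma polar_minus: "polar (- x) = - polar x"
  by (simp add: polar_def vec_eq_iff frob_minus sum_negf)

lemma polar_diff: "polar (x - y) = polar x - polar y"
  using polar_add[of x "- y"] polar_minus[of y] by simp

text \<open>
  Every plane is the polar plane of a point, because \<open>A\<close> is invertible and \<open>x \<mapsto> x\<^sup>q\<close> is an involution.
\<close>

lemma polar_surj: "\<exists>y. polar y = a"
proof -
  obtain A' where A': "A ** A' = mat 1"
    using nondeg by (auto simp: nondeg_hermitian_def invertible_def)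
  define z where "z = A' *v a"
  have "polar (\<chi> j. (z $ j) ^ q) = A *v z"
    by (simp add: polar_def vec_eq_iff matrix_vector_mult_def)
  also have "\<dots> = a" by (simp add: z_def matrix_vector_mul_assoc A')
  finally show ?thesis by blast
qed

lemma polar_eq_0_iff [simp]: "polar y = 0 \<longleftrightarrow> y = 0"
proof
  assume *: "polar y = 0"
  obtain A' where A': "A' ** A = mat 1"
    using nondeg by (auto simp: nondeg_hermitian_def invertible_def)
  have "A *v (\<chi> j. (y $ j) ^ q) = 0"
    using * by (simp add: polar_def vec_eq_iff matrix_vector_mult_def)
  then have "A' *v (A *v (\<chi> j. (y $ j) ^ q)) = 0" by simp
  then have "(\<chi> j. (y $ j) ^ q) = 0" by (simp add: matrix_vector_mul_assoc A')
  then have "y $ j ^ q = 0" for j by (simp add: vec_eq_iff)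
  then show "y = 0" by (simp add: vec_eq_iff)
qed simp

lemma h_linear [simp]:
  "h (x + y) z = h x z + h y z" "h (x - y) z = h x z - h y z" "h (c *s x) z = c * h x z"
  "h z (x + y) = h z x + h z y" "h z (x - y) = h z x - h z y" "h z (c *s x) = c ^ q * h z x"
  "h 0 z = 0" "h z 0 = 0"
  by (simp_all add: h_def polar_add polar_diff polar_scale)

lemma h_commute: "h y x = (h x y) ^ q"
proof -
  have tr: "A $ j $ i = (A $ i $ j) ^ q" for i j
  proof -
    have "transpose A $ i $ j = (\<chi> i j. (A $ i $ j) ^ q) $ i $ j"
      using nondeg unfolding nondeg_hermitian_def by (simp only:)
    then show ?thesis by (simp only: transpose_def vec_lambda_beta)
  qed
  have "(h x y) ^ q = (\<Sum>i\<in>UNIV. \<Sum>j\<in>UNIV. (A $ i $ j) ^ q * y $ j * (x $ i) ^ q)"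
    by (simp add: h_def lf_def polar_def frob_sum power_mult_distrib sum_distrib_right)
  also have "\<dots> = (\<Sum>j\<in>UNIV. \<Sum>i\<in>UNIV. (A $ i $ j) ^ q * y $ j * (x $ i) ^ q)"
    by (rule sum.swap)
  also have "\<dots> = h y x"
    by (simp add: h_def lf_def polar_def sum_distrib_right flip: tr) (simp add: algebra_simps)
  finally show ?thesis by simp
qed

lemma h_eq_0_commute: "h x y = 0 \<longleftrightarrow> h y x = 0"
  using h_commute[of x y] h_commute[of y x] by auto

lemma hyperplane_polar: "hyperplane (polar p) = {x. h x p = 0}"
  by (simp add: hyperplane_def h_def)

definition V2 :: "('k ^ 4) set set" where
  "V2 = {P. \<exists>x. x \<noteq> 0 \<and> h x x = 0 \<and> P = vec.span {x}}"

text \<open>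
  The counterpart of \<open>zero_points\<close> for functions.
\<close>

definition zero_set :: "('k ^ 4 \<Rightarrow> 'k) \<Rightarrow> ('k ^ 4) set set" where
  "zero_set f = {P \<in> proj_points UNIV. \<forall>x\<in>P. f x = 0}"

lemma zero_set_form:
  assumes "form d f" "d > 0" "x \<noteq> 0"
  shows "vec.span {x} \<in> zero_set f \<longleftrightarrow> f x = 0"
proof -
  have "vec.span {x} \<in> proj_points UNIV"
    using assms(3) by (auto simp: proj_points_iff[OF vec.subspace_UNIV])
  moreover have "(\<forall>y\<in>vec.span {x}. f y = 0) \<longleftrightarrow> f x = 0"
    using form_scale[OF assms(1)] vec.span_base[of x "{x}"] by (auto simp: vec.span_singleton)
  ultimately show ?thesis by (simp add: zero_set_def)
qed

lemma card_trace_fibre: "card {b :: 'k. b + b ^ q = c} \<le> q"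
proof -
  let ?p = "monom 1 q + [:- c, 1:]"
  have "coeff ?p q = 1" using q3 by (simp add: coeff_pCons split: nat.split)
  then have "?p \<noteq> 0" by (metis coeff_0 zero_neq_one)
  then have "card {b. poly ?p b = 0} \<le> degree ?p" by (rule card_poly_roots_bound)
  also have "\<dots> \<le> q" using q3 by (intro degree_add_le) (auto simp: degree_monom_le)
  finally show ?thesis by (simp add: poly_monom algebra_simps)
qed

text \<open>
  The nonzero elements are distributed over the at most \<open>q - 1\<close> nonzero fixed elements of
  \<open>c \<mapsto> c\<^sup>q\<close>, with at most \<open>q + 1\<close> in each fibre of the norm. As \<open>q\<^sup>2 - 1 = (q - 1) (q + 1)\<close>, every fibre is
  full.
\<close>

lemma card_norm_fibre:
  assumes "c ^ q = (c :: 'k)" "c \<noteq> 0" shows "card {t :: 'k. t ^ (q + 1) = c} = q + 1"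
proof -
  let ?F = "\<lambda>c. {t :: 'k. t ^ (q + 1) = c}"
  let ?C = "{c :: 'k. c ^ q = c} - {0}"
  have le: "card (?F c) \<le> q + 1" for c
  proof -
    let ?p = "monom 1 (q + 1) - [:c:]"
    have "coeff ?p (q + 1) = 1" by (simp add: coeff_pCons split: nat.split)
    then have "?p \<noteq> 0" by (metis coeff_0 zero_neq_one)
    then have "card {b. poly ?p b = 0} \<le> degree ?p" by (rule card_poly_roots_bound)
    also have "\<dots> \<le> q + 1" by (intro degree_diff_le) (auto simp: degree_monom_le)
    finally show ?thesis by (simp add: poly_monom algebra_simps)
  qed
  have C: "card ?C \<le> q - 1"
  proof -
    let ?p = "monom 1 q - [:0, 1 :: 'k:]"
    have "coeff ?p q = 1" using q3 by (simp add: coeff_pCons split: nat.split)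
    then have "?p \<noteq> 0" by (metis coeff_0 zero_neq_one)
    then have "card {b. poly ?p b = 0} \<le> degree ?p" by (rule card_poly_roots_bound)
    also have "\<dots> \<le> q" using q3 by (intro degree_diff_le) (auto simp: degree_monom_le)
    finally have "card {c :: 'k. c ^ q = c} \<le> q" by (simp add: poly_monom)
    then show ?thesis by (subst card_Diff_singleton) auto
  qed
  have "UNIV - {0 :: 'k} = (\<Union>c\<in>?C. ?F c)"
    by (auto simp: power_mult_distrib mult.commute)
  then have "card (UNIV - {0 :: 'k}) = card (\<Union>c\<in>?C. ?F c)" by simp
  also have "\<dots> = (\<Sum>c\<in>?C. card (?F c))" by (rule card_UN_disjoint) auto
  also have "\<dots> = card (?F c) + (\<Sum>c\<in>?C - {c}. card (?F c))"
    by (rule sum.remove) (use assms in auto)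
  also have "(\<Sum>c\<in>?C - {c}. card (?F c)) \<le> card (?C - {c}) * (q + 1)"
    using sum_bounded_above[of "?C - {c}" "\<lambda>c. card (?F c)" "q + 1"] le by simp
  also have "card (?C - {c}) = card ?C - 1" by (rule card_Diff_singleton) (use assms in auto)
  also have "(card ?C - 1) * (q + 1) \<le> (q - 2) * (q + 1)" using C by (intro mult_le_mono) auto
  finally have "card (UNIV - {0 :: 'k}) \<le> card (?F c) + (q - 2) * (q + 1)" by simp
  moreover have "card (UNIV - {0 :: 'k}) = q\<^sup>2 - 1" by (simp add: card_field)
  ultimately have "q\<^sup>2 - 1 \<le> card (?F c) + (q - 2) * (q + 1)" by simp
  moreover obtain u where "q = u + 3" using q3 by (metis add.commute le_Suc_ex)
  ultimately have "q + 1 \<le> card (?F c)" by (simp add: power2_eq_square algebra_simps)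
  then show ?thesis using le[of c] by simp
qed

lemma ex_trace_nonzero: "\<exists>c :: 'k. c + c ^ q \<noteq> 0"
proof (rule ccontr)
  assume "\<not> ?thesis"
  then have "{c :: 'k. c + c ^ q = 0} = UNIV" by auto
  then have "q\<^sup>2 \<le> q" using card_trace_fibre[of 0] card_field by simp
  then show False using q3 by (simp add: power2_eq_square)
qed

lemma h_self_fixed: "(h x x) ^ q = h x x"
  using h_commute[of x x] by simp

text \<open>
  The form is nondegenerate on the span of \<open>p\<close> and \<open>p'\<close>, its Gram determinant being
  \<open>- h p p' * h p' p\<close>, hence also on the line orthogonal to both. That line has an orthogonal basis \<open>r'\<close>, \<open>r\<close> of
  anisotropic vectors, and \<open>r' + t r\<close> is isotropic if and only if the norm \<open>t\<^bsup>q + 1\<^esup>\<close> has a certain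
  nonzero value.
\<close>

lemma many_isotropic_points:
  assumes p: "p \<noteq> 0" "h p p = 0" and p': "h p p' \<noteq> 0"
  shows "card {P. \<exists>x. x \<noteq> 0 \<and> h x x = 0 \<and> h x p = 0 \<and> h x p' = 0 \<and> P = vec.span {x}} \<ge> q + 1"
proof -
  define L where "L = hyperplane (polar p) \<inter> hyperplane (polar p')"
  have memL: "x \<in> L \<longleftrightarrow> h x p = 0 \<and> h x p' = 0" for x
    by (simp add: L_def hyperplane_polar)
  have p'p: "h p' p \<noteq> 0" using p' h_eq_0_commute by blast
  have line: "is_line L"
    unfolding L_def
  proof (rule is_line_inter_hyperplanes)
    show "polar p \<noteq> 0" using p by simp
    fix c show "polar p' \<noteq> c *s polar p"
    proof
      assume "polar p' = c *s polar p"
      then have "h p p' = c * h p p" by (simp add: h_def)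
      then show False using p p' by simp
    qed
  qed
  then have sub: "vec.subspace L" by (simp add: is_line_def)
  have nondeg_L: "x = 0" if "x \<in> L" "\<And>y. y \<in> L \<Longrightarrow> h y x = 0" for x
  proof -
    have px: "h p x = 0" "h p' x = 0" using that(1) h_eq_0_commute by (auto simp: memL)
    have "h v x = 0" for v
    proof -
      define \<beta> where "\<beta> = h v p / h p' p"
      define \<alpha> where "\<alpha> = (h v p' - \<beta> * h p' p') / h p p'"
      have "v - \<alpha> *s p - \<beta> *s p' \<in> L"
        using p p' p'p by (simp add: memL \<alpha>_def \<beta>_def)
      then have "h (v - \<alpha> *s p - \<beta> *s p') x = 0" by (rule that(2))
      then show ?thesis using px by simp
    qed
    then have "\<forall>v. lf (polar x) v = lf 0 v" by (simp add: h_def)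
    then have "polar x = 0" using lf_eq_iff by blast
    then show "x = 0" by simp
  qed
  have ex_r: "\<exists>r\<in>L. h r r \<noteq> 0"
  proof (rule ccontr)
    assume "\<not> ?thesis"
    then have iso: "h x x = 0" if "x \<in> L" for x using that by blast
    have "\<not> L \<subseteq> {0}" using line vec.dim_eq_0[of L] by (auto simp: is_line_def)
    then obtain x where x: "x \<in> L" "x \<noteq> 0" by blast
    then obtain y where y: "y \<in> L" "h y x \<noteq> 0" using nondeg_L by blast
    \<comment> \<open>polarisation: scale \<open>y\<close> so that \<open>h z x\<close> has nonzero trace\<close>
    obtain c :: 'k where c: "c + c ^ q \<noteq> 0" using ex_trace_nonzero by blast
    define z where "z = (c / h y x) *s y"
    have "z \<in> L" unfolding z_def using sub y(1) by (rule vec.subspace_scale)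
    moreover have "x + z \<in> L" using sub x(1) \<open>z \<in> L\<close> by (rule vec.subspace_add)
    ultimately have "h (x + z) (x + z) = 0" "h z z = 0" using iso by blast+
    then have "h z x + h x z = 0" using iso[OF x(1)] by simp
    moreover have "h z x = c" using y by (simp add: z_def)
    moreover have "h x z = c ^ q" using \<open>h z x = c\<close> h_commute[of x z] by simp
    ultimately show False using c by simp
  qed
  then obtain r where r: "r \<in> L" "h r r \<noteq> 0" by blast
  have "\<not> L \<subseteq> vec.span {r}"
  proof
    assume "L \<subseteq> vec.span {r}"
    then have "vec.dim L \<le> card {r}" by (rule vec.dim_le_card) simp
    then show False using line by (simp add: is_line_def)
  qed
  then obtain y where y: "y \<in> L" "y \<notin> vec.span {r}" by blast
  define r' where "r' = y - (h y r / h r r) *s r"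
  have r'L: "r' \<in> L" using y r sub by (simp add: r'_def vec.subspace_diff vec.subspace_scale)
  have r'0: "r' \<noteq> 0"
  proof
    assume "r' = 0"
    then have "y = (h y r / h r r) *s r" by (simp add: r'_def)
    then show False using y(2) by (metis vec.span_base vec.span_scale singletonI)
  qed
  have r'r: "h r' r = 0" using r by (simp add: r'_def)
  then have rr': "h r r' = 0" using h_eq_0_commute by blast
  have indep: "indep2 r' r"
    unfolding indep2_def
  proof (intro allI impI)
    fix \<alpha> \<beta> assume eq: "\<alpha> *s r' + \<beta> *s r = 0"
    then have "h (\<alpha> *s r' + \<beta> *s r) r = 0" by simp
    then have "\<beta> = 0" using r r'r by simp
    then show "\<alpha> = 0 \<and> \<beta> = 0" using eq r'0 by simp
  qed
  have r'r': "h r' r' \<noteq> 0"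
  proof
    assume iso: "h r' r' = 0"
    have "h y r' = 0" if "y \<in> L" for y
    proof -
      have "y \<in> vec.span {r', r}" using that span_pair_eq_line[OF line r'L r(1) indep] by simp
      then obtain \<alpha> \<beta> where "y = \<alpha> *s r' + \<beta> *s r" by (auto simp: span_pair)
      then show ?thesis using iso rr' by simp
    qed
    then show False using nondeg_L[OF r'L] r'0 by blast
  qed
  define c where "c = - h r' r' / h r r"
  have "c ^ q = c" by (simp add: c_def power_divide frob_minus h_self_fixed)
  moreover have "c \<noteq> 0" using r r'r' by (simp add: c_def)
  ultimately have card: "card {t. t ^ (q + 1) = c} = q + 1" by (rule card_norm_fibre)
  let ?pt = "\<lambda>t. vec.span {r' + t *s r}"
  let ?I = "{P. \<exists>x. x \<noteq> 0 \<and> h x x = 0 \<and> h x p = 0 \<and> h x p' = 0 \<and> P = vec.span {x}}"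
  have nz: "r' + t *s r \<noteq> 0" for t
    using indep[unfolded indep2_def, rule_format, of 1 t] by auto
  have inj: "inj ?pt"
  proof (rule injI)
    fix s t assume "?pt s = ?pt t"
    then obtain k where k: "r' + s *s r = k *s (r' + t *s r)"
      using span_singleton_eqD[OF _ nz[of s]] by blast
    then have "(1 - k) *s r' + (s - k * t) *s r = 0"
      by (simp add: algebra_simps vec.scale_left_diff_distrib vec.scale_right_distrib)
    then have "1 - k = 0 \<and> s - k * t = 0" using indep unfolding indep2_def by blast
    then show "s = t" by simp
  qed
  have "?pt ` {t. t ^ (q + 1) = c} \<subseteq> ?I"
  proof clarify
    fix t assume t: "c = t ^ (q + 1)"
    have "h (r' + t *s r) (r' + t *s r) = h r' r' + t ^ (q + 1) * h r r"
      using r'r rr' by simp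
    also have "\<dots> = h r' r' + c * h r r" by (simp only: t)
    also have "\<dots> = 0" using r by (simp add: c_def)
    finally have "h (r' + t *s r) (r' + t *s r) = 0" .
    moreover have "h (r' + t *s r) p = 0" "h (r' + t *s r) p' = 0"
      using r'L r(1) by (simp_all add: memL)
    ultimately show "\<exists>x. x \<noteq> 0 \<and> h x x = 0 \<and> h x p = 0 \<and> h x p' = 0 \<and> ?pt t = vec.span {x}"
      using nz by blast
  qed
  moreover have "finite ?I" by (rule finite_subset[of _ UNIV]) auto
  ultimately have "card (?pt ` {t. t ^ (q + 1) = c}) \<le> card ?I" by (intro card_mono)
  then show ?thesis using card by (simp add: card_image[OF inj_on_subset[OF inj]])
qed

text \<open>
  A point orthogonal to \<open>p\<close> and to some \<open>p'\<close> not orthogonal to \<open>p\<close> differs from \<open>p\<close>, and together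
  with \<open>p\<close> it spans a generator.
\<close>

lemma ex_generator:
  assumes p: "p \<noteq> 0" "h p p = 0"
  shows "\<exists>r. indep2 p r \<and> h r r = 0 \<and> h r p = 0"
proof -
  obtain p' where p': "h p p' \<noteq> 0"
  proof -
    have "\<not> (\<forall>v. lf (polar p) v = lf 0 v)" using lf_eq_iff[of "polar p" 0] p by simp
    then obtain v where "h v p \<noteq> 0" by (auto simp: h_def)
    then show ?thesis using that h_eq_0_commute by blast
  qed
  have "{P. \<exists>x. x \<noteq> 0 \<and> h x x = 0 \<and> h x p = 0 \<and> h x p' = 0 \<and> P = vec.span {x}} \<noteq> {}"
    using many_isotropic_points[OF p p'] by (metis card.empty le_add2 not_one_le_zero order_trans)
  then obtain r where r: "r \<noteq> 0" "h r r = 0" "h r p = 0" "h r p' = 0" by blast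
  have "indep2 p r"
    unfolding indep2_def
  proof (intro allI impI)
    fix \<alpha> \<beta> assume eq: "\<alpha> *s p + \<beta> *s r = 0"
    then have "h (\<alpha> *s p + \<beta> *s r) p' = 0" by simp
    then have "\<alpha> = 0" using r p' by simp
    then show "\<alpha> = 0 \<and> \<beta> = 0" using eq r by simp
  qed
  then show ?thesis using r by blast
qed

end

section \<open>The surface seen from a generator\<close>

text \<open>
  A generator with basis \<open>p0\<close>, \<open>p1\<close>, completed by vectors that are dual to this basis with respect to
  the Hermitian form.
\<close>

locale generator_frame = hermitian_surface q A
  for q :: nat and A :: "'k::{field, finite} ^ 4 ^ 4" +
  fixes p0 p1 e1 e2 :: "'k ^ 4"
  assumes indep: "indep2 p0 p1"
    and iso: "h p0 p0 = 0" "h p0 p1 = 0" "h p1 p1 = 0"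
    and dual: "h e1 p0 = 1" "h e1 p1 = 0" "h e2 p0 = 0" "h e2 p1 = 1"
begin

lemma p1_p0 [simp]: "h p1 p0 = 0"
  using iso(2) h_eq_0_commute by blast

lemma dual_commute [simp]: "h p0 e1 = 1" "h p1 e1 = 0" "h p0 e2 = 0" "h p1 e2 = 1"
  using h_commute[of p0 e1] h_commute[of p1 e1] h_commute[of p0 e2] h_commute[of p1 e2] dual
  by simp_all

lemmas [simp] = iso dual

abbreviation pt :: "'k \<Rightarrow> 'k ^ 4" where
  "pt t \<equiv> p0 + t *s p1"

text \<open>
  The vector \<open>t\<^sup>q e1 - e2\<close> completes the generator to the tangent plane at \<open>pt t\<close>, and \<open>e1\<close> does so at
  \<open>p1\<close>. Varying \<open>a\<close> moves along the line that joins the point of tangency with the point labelled by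
  \<open>b\<close>. The trivial coefficients are kept to match the expansion of a form along the generator.
\<close>

definition aff :: "'k \<Rightarrow> 'k \<Rightarrow> 'k \<Rightarrow> 'k ^ 4" where
  "aff t a b = a *s p0 + (a * t + b) *s p1 + (t ^ q) *s e1 + (-1) *s e2"

definition aff_inf :: "'k \<Rightarrow> 'k \<Rightarrow> 'k ^ 4" where
  "aff_inf a b = b *s p0 + a *s p1 + 1 *s e1 + 0 *s e2"

definition fibre :: "'k \<Rightarrow> 'k set" where
  "fibre t = {b. h (aff t 0 b) (aff t 0 b) = 0}"

definition fibre_inf :: "'k set" where
  "fibre_inf = {b. h (aff_inf 0 b) (aff_inf 0 b) = 0}"

lemma p_nonzero: "p0 \<noteq> 0" "p1 \<noteq> 0" "pt t \<noteq> 0"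
proof -
  have *: "\<alpha> *s p0 + \<beta> *s p1 = 0 \<Longrightarrow> \<alpha> = 0 \<and> \<beta> = 0" for \<alpha> \<beta>
    using indep unfolding indep2_def by blast
  show "p0 \<noteq> 0" using *[of 1 0] by fastforce
  show "p1 \<noteq> 0" using *[of 0 1] by fastforce
  show "pt t \<noteq> 0"
  proof
    assume "pt t = 0"
    then have "1 *s p0 + t *s p1 = 0" by (simp only: vec.scale_one)
    from *[OF this] show False by simp
  qed
qed

lemma coordinates: "\<exists>\<alpha> \<beta>. x = \<alpha> *s p0 + \<beta> *s p1 + h x p0 *s e1 + h x p1 *s e2"
proof -
  let ?L = "hyperplane (polar p0) \<inter> hyperplane (polar p1)"
  let ?x = "x - h x p0 *s e1 - h x p1 *s e2"
  have L: "is_line ?L"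
  proof (rule is_line_inter_hyperplanes)
    show "polar p0 \<noteq> 0" using p_nonzero by simp
    fix c show "polar p1 \<noteq> c *s polar p0"
    proof
      assume "polar p1 = c *s polar p0"
      then have "h e2 p1 = c * h e2 p0" by (simp add: h_def)
      then show False by simp
    qed
  qed
  have "?x \<in> ?L" by (simp add: hyperplane_polar)
  also have "?L = vec.span {p0, p1}"
    by (rule span_pair_eq_line[symmetric, OF L _ _ indep]) (simp_all add: hyperplane_polar)
  finally obtain \<alpha> \<beta> where eq: "?x = \<alpha> *s p0 + \<beta> *s p1" unfolding span_pair by blast
  have "x = ?x + h x p0 *s e1 + h x p1 *s e2" by simp
  then have "x = \<alpha> *s p0 + \<beta> *s p1 + h x p0 *s e1 + h x p1 *s e2" unfolding eq .
  then show ?thesis by blast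
qed

text \<open>
  A generator is its own orthogonal space.
\<close>

lemma perp_line:
  assumes "h x p0 = 0" "h x p1 = 0" shows "x \<in> vec.span {p0, p1}"
proof -
  obtain \<alpha> \<beta> where "x = \<alpha> *s p0 + \<beta> *s p1 + h x p0 *s e1 + h x p1 *s e2"
    using coordinates by blast
  then have "x = \<alpha> *s p0 + \<beta> *s p1 + 0 *s e1 + 0 *s e2" unfolding assms .
  then show ?thesis unfolding span_pair by auto
qed

lemma h_aff:
  "h (aff t a b) p0 = t ^ q" "h (aff t a b) p1 = -1" "h (aff t a b) (pt t) = 0"
  by (simp_all add: aff_def frob_minus)

lemma h_aff_inf: "h (aff_inf a b) p0 = 1" "h (aff_inf a b) p1 = 0"
  by (simp_all add: aff_inf_def)

lemma perp_pt:
  assumes "h x (pt t) = 0"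
  shows "x \<in> vec.span {p0, p1} \<or> (\<exists>c a b. c \<noteq> 0 \<and> x = c *s aff t a b)"
proof (cases "h x p1 = 0")
  case True
  then have "h x p0 = 0" using assms by simp
  then show ?thesis using True perp_line by blast
next
  case False
  define c where "c = - h x p1"
  have c0: "c \<noteq> 0" using False by (simp add: c_def)
  have hx: "h x p0 = c * t ^ q" "h x p1 = c * (-1)"
    using assms by (simp_all add: c_def eq_neg_iff_add_eq_0 mult.commute)
  obtain \<alpha> \<beta> where "x = \<alpha> *s p0 + \<beta> *s p1 + h x p0 *s e1 + h x p1 *s e2"
    using coordinates by blast
  then have "x = \<alpha> *s p0 + \<beta> *s p1 + (c * t ^ q) *s e1 + (c * (-1)) *s e2" unfolding hx .
  also have "\<dots> = c *s aff t (\<alpha> / c) (\<beta> / c - (\<alpha> / c) * t)"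
    using c0 by (simp add: aff_def vec_eq_iff algebra_simps)
  finally show ?thesis using c0 by blast
qed

lemma perp_inf:
  assumes "h x p1 = 0"
  shows "x \<in> vec.span {p0, p1} \<or> (\<exists>c a b. c \<noteq> 0 \<and> x = c *s aff_inf a b)"
proof (cases "h x p0 = 0")
  case True
  then show ?thesis using assms perp_line by blast
next
  case False
  define c where "c = h x p0"
  have c0: "c \<noteq> 0" using False by (simp add: c_def)
  obtain \<alpha> \<beta> where "x = \<alpha> *s p0 + \<beta> *s p1 + h x p0 *s e1 + h x p1 *s e2"
    using coordinates by blast
  then have "x = \<alpha> *s p0 + \<beta> *s p1 + c *s e1 + 0 *s e2" unfolding assms c_def .
  also have "\<dots> = c *s aff_inf (\<beta> / c) (\<alpha> / c)"
    using c0 by (simp add: aff_inf_def vec_eq_iff algebra_simps)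
  finally show ?thesis using c0 by blast
qed

text \<open>
  Each point lies in the tangent plane at some point of the generator; the parameter is found by
  inverting \<open>t \<mapsto> t\<^sup>q\<close>.
\<close>

lemma perp_cases: "h x p1 = 0 \<or> (\<exists>t. h x (pt t) = 0)"
proof (cases "h x p1 = 0")
  case False
  define t where "t = (- h x p0 / h x p1) ^ q"
  have "t ^ q = - h x p0 / h x p1" by (simp add: t_def)
  then have "h x (pt t) = 0" using False by simp
  then show ?thesis by blast
qed simp

text \<open>
  Isotropy depends only on \<open>b\<close>, so the surface meets the tangent plane in lines through the point of
  tangency; the equation for \<open>b\<close> is a trace equation and has at most \<open>q\<close> solutions.
\<close>

lemma h_aff_self: "h (aff t a b) (aff t a b) = h (aff t 0 0) (aff t 0 0) - (b + b ^ q)"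
  by (simp add: aff_def frob_minus frob_add power_mult_distrib algebra_simps)

lemma h_aff_inf_self: "h (aff_inf a b) (aff_inf a b) = h e1 e1 + (b + b ^ q)"
  by (simp add: aff_inf_def algebra_simps)

lemma fibre_iff: "h (aff t a b) (aff t a b) = 0 \<longleftrightarrow> b \<in> fibre t"
  unfolding fibre_def mem_Collect_eq h_aff_self[of t a b] h_aff_self[of t 0 b] ..

lemma fibre_inf_iff: "h (aff_inf a b) (aff_inf a b) = 0 \<longleftrightarrow> b \<in> fibre_inf"
  unfolding fibre_inf_def mem_Collect_eq h_aff_inf_self ..

lemma card_fibre: "card (fibre t) \<le> q"
proof -
  have "h (aff t 0 b) (aff t 0 b) = 0 \<longleftrightarrow> b + b ^ q = h (aff t 0 0) (aff t 0 0)" for b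
    by (subst h_aff_self) (auto simp only: right_minus_eq)
  then have "fibre t = {b. b + b ^ q = h (aff t 0 0) (aff t 0 0)}" unfolding fibre_def by simp
  then show ?thesis using card_trace_fibre by simp
qed

lemma card_fibre_inf: "card fibre_inf \<le> q"
proof -
  have "fibre_inf = {b. b + b ^ q = - h e1 e1}"
    unfolding fibre_inf_def h_aff_inf_self by (auto simp: add_eq_0_iff)
  then show ?thesis using card_trace_fibre by simp
qed

lemma points_on_generator:
  assumes "x \<in> vec.span {p0, p1}" "x \<noteq> 0"
  shows "vec.span {x} \<in> insert (vec.span {p1}) ((\<lambda>t. vec.span {pt t}) ` UNIV)"
proof -
  obtain \<alpha> \<beta> where x: "x = \<alpha> *s p0 + \<beta> *s p1" using assms(1) by (auto simp: span_pair)
  show ?thesis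
  proof (cases "\<alpha> = 0")
    case True
    then have "x = \<beta> *s p1" "\<beta> \<noteq> 0" using x assms(2) by auto
    then have "vec.span {x} = vec.span {p1}" using span_singleton_scale by blast
    then show ?thesis by blast
  next
    case False
    then have "x = \<alpha> *s pt (\<beta> / \<alpha>)" using x by (simp add: vec_eq_iff algebra_simps)
    then have "vec.span {x} = vec.span {pt (\<beta> / \<alpha>)}" using False span_singleton_scale by metis
    then show ?thesis by blast
  qed
qed

text \<open>
  Outside the generator, the surface is the union of the other lines that it has in the tangent planes
  at the points of the generator. Points are represented by the normalised vectors of these planes.
\<close>

lemma count_V2:
  assumes f: "form d f" "d > 0"
    and n: "card {P \<in> zero_set f. \<exists>x\<in>vec.span {p0, p1}. x \<noteq> 0 \<and> P = vec.span {x}} \<le> n"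
  shows "card (zero_set f \<inter> V2) \<le> n
     + (\<Sum>t\<in>UNIV. card {(a, b). b \<in> fibre t \<and> f (aff t a b) = 0})
     + card {(a, b). b \<in> fibre_inf \<and> f (aff_inf a b) = 0}"
proof -
  let ?L = "{P \<in> zero_set f. \<exists>x\<in>vec.span {p0, p1}. x \<noteq> 0 \<and> P = vec.span {x}}"
  let ?S = "\<lambda>t. {(a, b). b \<in> fibre t \<and> f (aff t a b) = 0}"
  let ?S' = "{(a, b). b \<in> fibre_inf \<and> f (aff_inf a b) = 0}"
  let ?U = "\<Union>t\<in>UNIV. (\<lambda>(a, b). vec.span {aff t a b}) ` ?S t"
  let ?U' = "(\<lambda>(a, b). vec.span {aff_inf a b}) ` ?S'"
  have "zero_set f \<inter> V2 \<subseteq> ?L \<union> ?U \<union> ?U'"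
  proof
    fix P assume P: "P \<in> zero_set f \<inter> V2"
    then obtain x where x: "x \<noteq> 0" "h x x = 0" "P = vec.span {x}" by (auto simp: V2_def)
    then have fx: "f x = 0" using P zero_set_form[OF f] by blast
    have *: "vec.span {c *s y} = vec.span {y} \<and> f y = 0 \<and> h y y = 0"
      if "c \<noteq> 0" "x = c *s y" for c y
      using that fx x(2) form_scale[OF f(1), of c y] by (auto simp: span_singleton_scale)
    show "P \<in> ?L \<union> ?U \<union> ?U'"
    proof (cases "x \<in> vec.span {p0, p1}")
      case True
      then show ?thesis using x P by blast
    next
      case False
      then consider t c a b where "c \<noteq> 0" "x = c *s aff t a b" | c a b where "c \<noteq> 0" "x = c *s aff_inf a b"
        using perp_cases[of x] perp_pt[of x] perp_inf[of x] by blast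
      then show ?thesis
      proof cases
        case 1
        then have "b \<in> fibre t" "f (aff t a b) = 0" "P = vec.span {aff t a b}"
          using *[OF 1] x(3) fibre_iff by auto
        then have "P \<in> ?U" by force
        then show ?thesis by blast
      next
        case 2
        then have "b \<in> fibre_inf" "f (aff_inf a b) = 0" "P = vec.span {aff_inf a b}"
          using *[OF 2] x(3) fibre_inf_iff by auto
        then have "P \<in> ?U'" by force
        then show ?thesis by blast
      qed
    qed
  qed
  then have "card (zero_set f \<inter> V2) \<le> card (?L \<union> ?U \<union> ?U')" by (intro card_mono) auto
  also have "\<dots> \<le> card ?L + card ?U + card ?U'"
    using card_Un_le[of "?L \<union> ?U" ?U'] card_Un_le[of ?L ?U] by linarith
  also have "card ?U \<le> (\<Sum>t\<in>UNIV. card ((\<lambda>(a, b). vec.span {aff t a b}) ` ?S t))"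
    by (rule card_UN_le) simp
  also have "\<dots> \<le> (\<Sum>t\<in>UNIV. card (?S t))" by (intro sum_mono card_image_le) simp
  also have "card ?U' \<le> card ?S'" by (rule card_image_le) simp
  finally show ?thesis using n by linarith
qed

lemma card_generator_le:
  "card {P \<in> zero_set f. \<exists>x\<in>vec.span {p0, p1}. x \<noteq> 0 \<and> P = vec.span {x}} \<le> q\<^sup>2 + 1"
proof -
  have "{P \<in> zero_set f. \<exists>x\<in>vec.span {p0, p1}. x \<noteq> 0 \<and> P = vec.span {x}}
      \<subseteq> insert (vec.span {p1}) ((\<lambda>t. vec.span {pt t}) ` UNIV)"
    using points_on_generator by blast
  then have "card {P \<in> zero_set f. \<exists>x\<in>vec.span {p0, p1}. x \<noteq> 0 \<and> P = vec.span {x}}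
      \<le> card (insert (vec.span {p1}) ((\<lambda>t. vec.span {pt t}) ` UNIV))" by (intro card_mono) auto
  also have "\<dots> \<le> Suc (card ((\<lambda>t. vec.span {pt t}) ` UNIV))" by (rule card_insert_le_m1) auto
  also have "\<dots> \<le> Suc (CARD('k))" by (intro Suc_le_mono[THEN iffD2] card_image_le) simp
  finally show ?thesis by (simp add: card_field)
qed

text \<open>
  The multiplicity \<open>e\<close> is the least transversal degree that occurs in the expansion of \<open>f\<close> along the
  generator. It is positive since \<open>f\<close> vanishes on the generator, and no section is identically zero
  since otherwise \<open>f\<close> would vanish on a tangent plane.
\<close>

lemma count_containing_generator:
  assumes f: "form d f" and d: "1 \<le> d" "d \<le> q"
    and no_plane: "\<And>a. a \<noteq> 0 \<Longrightarrow> \<exists>x\<in>hyperplane a. f x \<noteq> 0"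
    and gen: "\<And>x. x \<in> vec.span {p0, p1} \<Longrightarrow> f x = 0"
  shows "card (zero_set f \<inter> V2) \<le> d * q ^ 3 + (d - 1) * q\<^sup>2 + 1"
proof -
  obtain \<phi>' where deg': "\<And>k l. degree (\<phi>' k l) \<le> d - k - l" and f': "\<And>s t y z.
      f (s *s p0 + t *s p1 + y *s e1 + z *s e2) =
        (\<Sum>(k, l)\<in>mons d. y ^ k * z ^ l * hpoly (d - k - l) (\<phi>' k l) s t)"
    using form_along_line[OF f, of p0 p1 e1 e2] by blast
  \<comment> \<open>coefficients beyond degree \<open>d\<close> do not occur in the expansion and are arbitrary; they must not disturb the choice of \<open>e\<close>\<close>
  define \<phi> where "\<phi> k l = (if k + l \<le> d then \<phi>' k l else 0)" for k l
  have deg: "degree (\<phi> k l) \<le> d - k - l" for k l using deg' by (simp add: \<phi>_def)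
  have f_eq: "f (s *s p0 + t *s p1 + y *s e1 + z *s e2) =
        (\<Sum>(k, l)\<in>mons d. y ^ k * z ^ l * hpoly (d - k - l) (\<phi> k l) s t)" for s t y z
    unfolding f' by (rule sum.cong) (auto simp: \<phi>_def mons_def)
  have "\<exists>n k l. k + l = n \<and> \<phi> k l \<noteq> 0"
  proof (rule ccontr)
    assume "\<not> ?thesis"
    then have z: "\<phi> k l = 0" for k l by blast
    have "f x = 0" for x
    proof -
      obtain \<alpha> \<beta> where x: "x = \<alpha> *s p0 + \<beta> *s p1 + h x p0 *s e1 + h x p1 *s e2"
        using coordinates by blast
      show ?thesis by (subst x, subst f_eq) (simp add: z case_prod_beta)
    qed
    then show False using no_plane[of p0] p_nonzero by blast
  qed
  then obtain e where e: "\<exists>k l. k + l = e \<and> \<phi> k l \<noteq> 0"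
    and least: "\<And>n. n < e \<Longrightarrow> \<not> (\<exists>k l. k + l = n \<and> \<phi> k l \<noteq> 0)"
    using exists_least_iff[of "\<lambda>n. \<exists>k l. k + l = n \<and> \<phi> k l \<noteq> 0"] by blast
  have "e \<le> d" using e by (auto simp: \<phi>_def split: if_splits)
  have "\<phi> 0 0 = 0"
  proof (rule poly_zero_on_field)
    have "q < q\<^sup>2" using q3 by (simp add: power2_eq_square)
    then show "degree (\<phi> 0 0) < CARD('k)" using deg[of 0 0] d by (simp add: card_field)
    fix t
    have "1 *s p0 + t *s p1 \<in> vec.span {p0, p1}" unfolding span_pair by blast
    then have "0 = f (1 *s p0 + t *s p1 + 0 *s e1 + 0 *s e2)" by (simp add: gen)
    also have "\<dots> = hpoly d (\<phi> 0 0) 1 t" unfolding f_eq sum_mons_zero by simp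
    also have "\<dots> = poly (\<phi> 0 0) t" using hpoly_nonzero[of "\<phi> 0 0" d 1 t] deg[of 0 0] by simp
    finally show "poly (\<phi> 0 0) t = 0" by simp
  qed
  then have "1 \<le> e" using e by (cases e) auto
  interpret pencil q d e \<phi>
    using card_field char \<open>1 \<le> e\<close> \<open>e \<le> d\<close> d(2) deg least e by unfold_locales blast+
  have tr: "f (aff t a b) = section_at t a b" for t a b
    unfolding aff_def f_eq section_at_def ..
  have tr': "f (aff_inf a b) = section_inf a b" for a b
    unfolding aff_inf_def f_eq section_inf_def by simp
  have nz: "\<exists>a b. section_at t a b \<noteq> 0" for t
  proof (rule ccontr)
    assume *: "\<not> ?thesis"
    obtain x where x: "h x (pt t) = 0" "f x \<noteq> 0"
      using no_plane[of "polar (pt t)"] p_nonzero(3)[of t] unfolding hyperplane_polar by auto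
    then show False using perp_pt[OF x(1)] gen * form_scale[OF f] by (auto simp flip: tr)
  qed
  have nz': "\<exists>a b. section_inf a b \<noteq> 0"
  proof (rule ccontr)
    assume *: "\<not> ?thesis"
    obtain x where x: "h x p1 = 0" "f x \<noteq> 0"
      using no_plane[of "polar p1"] p_nonzero(2) unfolding hyperplane_polar by auto
    then show False using perp_inf[OF x(1)] gen * form_scale[OF f] by (auto simp flip: tr')
  qed
  have "card (zero_set f \<inter> V2) \<le> (q\<^sup>2 + 1)
     + (\<Sum>t\<in>UNIV. card {(a, b). b \<in> fibre t \<and> section_at t a b = 0})
     + card {(a, b). b \<in> fibre_inf \<and> section_inf a b = 0}"
    using count_V2[OF f _ card_generator_le] d(1) by (simp add: tr tr')
  with pencil_count[of fibre fibre_inf, OF card_fibre card_fibre_inf nz nz'] show ?thesis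
    by linarith
qed

end

lemma form_on_line:
  fixes f :: "'k::field ^ 'n::finite \<Rightarrow> 'k"
  assumes f: "form d f" and nz: "\<exists>x\<in>vec.span {u, v}. f x \<noteq> 0"
  shows "card {a. f (v + a *s u) = 0} \<le> d"
proof -
  obtain p where p: "degree p \<le> d" "\<And>s t. f (s *s v + t *s u) = hpoly d p s t"
    using form_line_hpoly[OF f] by metis
  have "p \<noteq> 0"
  proof
    assume z: "p = 0"
    obtain x where x: "x \<in> vec.span {u, v}" "f x \<noteq> 0" using nz by blast
    then obtain \<alpha> \<beta> where "x = \<alpha> *s u + \<beta> *s v" unfolding span_pair by blast
    then have "f x = 0" using p(2)[of \<beta> \<alpha>] z by (simp add: add.commute)
    then show False using x by simp
  qed
  have "f (v + a *s u) = poly p a" for a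
    using p(2)[of 1 a] hpoly_nonzero[OF p(1), of 1 a] by simp
  then have "card {a. f (v + a *s u) = 0} = card {a. poly p a = 0}" by simp
  also have "\<dots> \<le> degree p" by (rule card_poly_roots_bound) fact
  finally show ?thesis using p(1) by simp
qed

lemma card_pairs_le:
  fixes B :: "'k::finite set"
  assumes "\<And>b. b \<in> B \<Longrightarrow> card {a :: 'k. P a b} \<le> m"
  shows "card {(a, b). b \<in> B \<and> P a b} \<le> card B * m"
proof -
  have "{(a, b). b \<in> B \<and> P a b} = (\<Union>b\<in>B. (\<lambda>a. (a, b)) ` {a. P a b})" by auto
  then have "card {(a, b). b \<in> B \<and> P a b} \<le> (\<Sum>b\<in>B. card ((\<lambda>a. (a, b)) ` {a. P a b}))"
    by (simp add: card_UN_le)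
  also have "\<dots> \<le> (\<Sum>b\<in>B. m)"
    by (intro sum_mono order.trans[OF card_image_le] assms) auto
  finally show ?thesis by simp
qed

lemma form_1_lf: "form 1 (lf a)"
  using form_lf[OF form_const[of 1], of a] by simp

context generator_frame
begin

text \<open>
  The generator of the frame has at most \<open>d + 1\<close> zeros (at most \<open>d\<close> of the form \<open>pt t\<close>, and possibly
  \<open>p1\<close>), and the at most \<open>q\<close> further generators through each of its \<open>q\<^sup>2 + 1\<close> points have at most \<open>d\<close>
  zeros away from it.
\<close>

lemma count_without_generator:
  assumes f: "form d f" and d: "1 \<le> d"
    and no_gen: "\<And>u v. indep2 u v \<Longrightarrow> h u u = 0 \<Longrightarrow> h v v = 0 \<Longrightarrow> h u v = 0 \<Longrightarrow>
      \<exists>x\<in>vec.span {u, v}. f x \<noteq> 0"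
  shows "card (zero_set f \<inter> V2) \<le> d + 1 + (q\<^sup>2 + 1) * (q * d)"
proof -
  have on_gen: "card {P \<in> zero_set f. \<exists>x\<in>vec.span {p0, p1}. x \<noteq> 0 \<and> P = vec.span {x}} \<le> d + 1"
  proof -
    have "{P \<in> zero_set f. \<exists>x\<in>vec.span {p0, p1}. x \<noteq> 0 \<and> P = vec.span {x}}
        \<subseteq> insert (vec.span {p1}) ((\<lambda>t. vec.span {pt t}) ` {t. f (pt t) = 0})"
    proof clarify
      fix x assume x: "vec.span {x} \<in> zero_set f" "x \<in> vec.span {p0, p1}" "x \<noteq> 0"
        and "vec.span {x} \<notin> (\<lambda>t. vec.span {pt t}) ` {t. f (pt t) = 0}"
      moreover have "f (pt t) = 0" if "vec.span {x} = vec.span {pt t}" for t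
        using x(1) that zero_set_form[OF f _ p_nonzero(3)] d by simp
      ultimately show "vec.span {x} = vec.span {p1}"
        using points_on_generator[OF x(2,3)] by blast
    qed
    then have "card {P \<in> zero_set f. \<exists>x\<in>vec.span {p0, p1}. x \<noteq> 0 \<and> P = vec.span {x}}
        \<le> card (insert (vec.span {p1}) ((\<lambda>t. vec.span {pt t}) ` {t. f (pt t) = 0}))"
      by (intro card_mono) auto
    also have "\<dots> \<le> Suc (card ((\<lambda>t. vec.span {pt t}) ` {t. f (pt t) = 0}))"
      by (rule card_insert_le_m1) auto
    also have "\<dots> \<le> Suc (card {t. f (pt t) = 0})"
      by (intro Suc_le_mono[THEN iffD2] card_image_le) simp
    also have "card {t. f (pt t) = 0} \<le> d"
    proof (rule form_on_line[OF f])
      have "indep2 p1 p0" using indep unfolding indep2_def by (metis add.commute)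
      then show "\<exists>x\<in>vec.span {p1, p0}. f x \<noteq> 0" by (rule no_gen) simp_all
    qed
    finally show ?thesis by simp
  qed
  have at: "card {(a, b). b \<in> fibre t \<and> f (aff t a b) = 0} \<le> q * d" for t
  proof -
    have "card {a. f (aff t a b) = 0} \<le> d" if b: "b \<in> fibre t" for b
    proof -
      have "indep2 (pt t) (aff t 0 b)"
        unfolding indep2_def
      proof (intro allI impI)
        fix \<alpha> \<beta> assume eq: "\<alpha> *s pt t + \<beta> *s aff t 0 b = 0"
        then have "h (\<alpha> *s pt t + \<beta> *s aff t 0 b) p1 = 0" by simp
        then have "\<beta> = 0" by (simp add: h_aff)
        then show "\<alpha> = 0 \<and> \<beta> = 0" using eq p_nonzero(3)[of t] by simp
      qed
      moreover have "h (pt t) (pt t) = 0" by simp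
      moreover have "h (aff t 0 b) (aff t 0 b) = 0" using b by (simp add: fibre_def)
      moreover have "h (pt t) (aff t 0 b) = 0" using h_aff(3) h_eq_0_commute by blast
      ultimately have "\<exists>x\<in>vec.span {pt t, aff t 0 b}. f x \<noteq> 0" by (rule no_gen)
      then have "card {a. f (aff t 0 b + a *s pt t) = 0} \<le> d" by (rule form_on_line[OF f])
      moreover have "aff t 0 b + a *s pt t = aff t a b" for a
        by (simp add: aff_def vec_eq_iff algebra_simps)
      ultimately show ?thesis by simp
    qed
    then have "card {(a, b). b \<in> fibre t \<and> f (aff t a b) = 0} \<le> card (fibre t) * d"
      by (rule card_pairs_le)
    also have "\<dots> \<le> q * d" by (intro mult_le_mono1 card_fibre)
    finally show ?thesis .
  qed
  have inf: "card {(a, b). b \<in> fibre_inf \<and> f (aff_inf a b) = 0} \<le> q * d"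
  proof -
    have "card {a. f (aff_inf a b) = 0} \<le> d" if b: "b \<in> fibre_inf" for b
    proof -
      have "indep2 p1 (aff_inf 0 b)"
        unfolding indep2_def
      proof (intro allI impI)
        fix \<alpha> \<beta> assume eq: "\<alpha> *s p1 + \<beta> *s aff_inf 0 b = 0"
        then have "h (\<alpha> *s p1 + \<beta> *s aff_inf 0 b) p0 = 0" by simp
        then have "\<beta> = 0" by (simp add: h_aff_inf)
        then show "\<alpha> = 0 \<and> \<beta> = 0" using eq p_nonzero(2) by simp
      qed
      moreover have "h p1 p1 = 0" by simp
      moreover have "h (aff_inf 0 b) (aff_inf 0 b) = 0" using b by (simp add: fibre_inf_def)
      moreover have "h p1 (aff_inf 0 b) = 0" using h_aff_inf(2) h_eq_0_commute by blast
      ultimately have "\<exists>x\<in>vec.span {p1, aff_inf 0 b}. f x \<noteq> 0" by (rule no_gen)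
      then have "card {a. f (aff_inf 0 b + a *s p1) = 0} \<le> d" by (rule form_on_line[OF f])
      moreover have "aff_inf 0 b + a *s p1 = aff_inf a b" for a
        by (simp add: aff_inf_def vec_eq_iff algebra_simps)
      ultimately show ?thesis by simp
    qed
    then have "card {(a, b). b \<in> fibre_inf \<and> f (aff_inf a b) = 0} \<le> card fibre_inf * d"
      by (rule card_pairs_le)
    also have "\<dots> \<le> q * d" by (intro mult_le_mono1 card_fibre_inf)
    finally show ?thesis .
  qed
  have "(\<Sum>t\<in>UNIV. card {(a, b). b \<in> fibre t \<and> f (aff t a b) = 0}) \<le> (\<Sum>t\<in>(UNIV :: 'k set). q * d)"
    by (intro sum_mono at)
  then have "(\<Sum>t\<in>UNIV. card {(a, b). b \<in> fibre t \<and> f (aff t a b) = 0}) \<le> q\<^sup>2 * (q * d)"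
    by (simp add: card_field)
  moreover have "card (zero_set f \<inter> V2) \<le> d + 1
     + (\<Sum>t\<in>UNIV. card {(a, b). b \<in> fibre t \<and> f (aff t a b) = 0})
     + card {(a, b). b \<in> fibre_inf \<and> f (aff_inf a b) = 0}"
    using d by (intro count_V2[OF f _ on_gen]) simp
  moreover have "(q\<^sup>2 + 1) * (q * d) = q\<^sup>2 * (q * d) + q * d" by simp
  ultimately show ?thesis using inf by linarith
qed

text \<open>
  The tangent plane at \<open>p1\<close> meets the tangent planes at the other points of the generator only in the
  generator itself.
\<close>

lemma card_tangent_section: "card (zero_set (lf (polar p1)) \<inter> V2) \<le> q ^ 3 + q\<^sup>2 + 1"
proof -
  have f: "lf (polar p1) x = h x p1" for x by (simp add: h_def)
  have t: "{(a, b). b \<in> fibre t \<and> lf (polar p1) (aff t a b) = 0} = {}" for t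
    by (simp add: f h_aff)
  have "card {(a, b). b \<in> fibre_inf \<and> lf (polar p1) (aff_inf a b) = 0} \<le> card fibre_inf * q\<^sup>2"
  proof (rule card_pairs_le)
    fix b show "card {a. lf (polar p1) (aff_inf a b) = 0} \<le> q\<^sup>2"
      using card_mono[of UNIV "{a. lf (polar p1) (aff_inf a b) = 0}"] card_field by simp
  qed
  also have "\<dots> \<le> q * q\<^sup>2" by (intro mult_le_mono1 card_fibre_inf)
  also have "\<dots> = q ^ 3" by (simp add: power2_eq_square power3_eq_cube)
  finally show ?thesis
    using count_V2[OF form_1_lf[of "polar p1"] _ card_generator_le] by (simp add: t)
qed

text \<open>
  The plane is the polar plane of a point \<open>u\<close> which is orthogonal to the generator and therefore lies
  on it.
\<close>

lemma plane_containing_generator: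
  assumes "\<And>x. x \<in> vec.span {p0, p1} \<Longrightarrow> lf a x = 0"
  shows "\<exists>u. h u u = 0 \<and> a = polar u"
proof -
  obtain u where u: "a = polar u" using polar_surj by metis
  have "p0 \<in> vec.span {p0, p1}" "p1 \<in> vec.span {p0, p1}" by (auto intro: vec.span_base)
  then have "h p0 u = 0" "h p1 u = 0" using assms u by (simp_all add: h_def)
  then have "h u p0 = 0" "h u p1 = 0" using h_eq_0_commute by blast+
  then have "u \<in> vec.span {p0, p1}" by (rule perp_line)
  then obtain \<alpha> \<beta> where "u = \<alpha> *s p0 + \<beta> *s p1" unfolding span_pair by blast
  then have "h u u = 0" by simp
  then show ?thesis using u by blast
qed

end

section \<open>Plane sections and cubic forms\<close>

context hermitian_surface
begin

lemma ex_frame: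
  assumes ind: "indep2 p0 p1" and iso: "h p0 p0 = 0" "h p0 p1 = 0" "h p1 p1 = 0"
  shows "\<exists>e1 e2. generator_frame q A p0 p1 e1 e2"
proof -
  have np: "polar u \<noteq> c *s polar v" if "indep2 u v" for u v c
  proof
    assume "polar u = c *s polar v"
    \<comment> \<open>the polar vector is semilinear, so \<open>c\<close> is moved inside by applying \<open>x \<mapsto> x\<^sup>q\<close>, which is an involution\<close>
    then have "polar (u - c ^ q *s v) = 0" by (simp add: polar_diff polar_scale)
    then have "1 *s u + (- (c ^ q)) *s v = 0" by simp
    then show False using that unfolding indep2_def by (metis zero_neq_one)
  qed
  have ind': "indep2 p1 p0" using ind unfolding indep2_def by (metis add.commute)
  obtain e1 where e1: "h e1 p0 = 1" "h e1 p1 = 0"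
    using ex_dual_vector[OF np[OF ind]] by (auto simp: h_def)
  obtain e2 where e2: "h e2 p1 = 1" "h e2 p0 = 0"
    using ex_dual_vector[OF np[OF ind']] by (auto simp: h_def)
  have "generator_frame q A p0 p1 e1 e2"
    by unfold_locales (use ind iso e1 e2 in auto)
  then show ?thesis by blast
qed

lemma mem_section:
  assumes "form d f" "d > 0"
  shows "P \<in> zero_set f \<inter> V2 \<longleftrightarrow> (\<exists>x. x \<noteq> 0 \<and> h x x = 0 \<and> f x = 0 \<and> P = vec.span {x})"
  unfolding V2_def using zero_set_form[OF assms] by blast

text \<open>
  Any point of the surface lies on a generator, which provides a frame; if \<open>f\<close> vanishes on some
  generator, then that one is chosen.
\<close>

lemma section_without_plane:
  assumes f: "form d f" and d: "1 \<le> d" "d \<le> q"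
    and no_plane: "\<And>a. a \<noteq> 0 \<Longrightarrow> \<exists>x\<in>hyperplane a. f x \<noteq> 0"
  shows "card (zero_set f \<inter> V2) \<le> max (d * q ^ 3 + (d - 1) * q\<^sup>2 + 1) (d + 1 + (q\<^sup>2 + 1) * (q * d))"
proof (cases "zero_set f \<inter> V2 = {}")
  case False
  show ?thesis
  proof (cases "\<exists>u v. indep2 u v \<and> h u u = 0 \<and> h v v = 0 \<and> h u v = 0 \<and> (\<forall>x\<in>vec.span {u, v}. f x = 0)")
    case True
    then obtain u v where uv: "indep2 u v" "h u u = 0" "h u v = 0" "h v v = 0"
      and 0: "\<And>x. x \<in> vec.span {u, v} \<Longrightarrow> f x = 0" by blast
    obtain e1 e2 where "generator_frame q A u v e1 e2" using ex_frame[OF uv] by blast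
    then interpret generator_frame q A u v e1 e2 .
    show ?thesis using count_containing_generator[OF f d no_plane 0] by simp
  next
    case no_gen: False
    obtain p where "p \<noteq> 0" "h p p = 0" using False d by (auto simp: mem_section[OF f] V2_def)
    then obtain r where r: "indep2 p r" "h r r = 0" "h r p = 0" "h p p = 0" using ex_generator by blast
    then have "h p r = 0" using h_eq_0_commute by blast
    then obtain e1 e2 where "generator_frame q A p r e1 e2" using ex_frame r by blast
    then interpret generator_frame q A p r e1 e2 .
    have "card (zero_set f \<inter> V2) \<le> d + 1 + (q\<^sup>2 + 1) * (q * d)"
      by (rule count_without_generator[OF f d(1)]) (use no_gen in blast)
    then show ?thesis by simp
  qed
qed simp

lemma tangent_section:
  assumes "u \<noteq> 0" "h u u = 0"
  shows "card (zero_set (lf (polar u)) \<inter> V2) \<le> q ^ 3 + q\<^sup>2 + 1"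
proof -
  obtain r where r: "indep2 u r" "h r r = 0" "h r u = 0" using ex_generator assms by blast
  have "indep2 r u" using r(1) unfolding indep2_def by (metis add.commute)
  then obtain e1 e2 where "generator_frame q A r u e1 e2" using ex_frame r assms by blast
  then interpret generator_frame q A r u e1 e2 .
  show ?thesis by (rule card_tangent_section)
qed

text \<open>
  A plane without generators falls under the count for linear forms that vanish on no generator.
\<close>

lemma plane_section:
  assumes "a \<noteq> 0"
  shows "card (zero_set (lf a) \<inter> V2) \<le> q ^ 3 + q + 2 \<or> (\<exists>u. u \<noteq> 0 \<and> h u u = 0 \<and> a = polar u)"
proof (cases "zero_set (lf a) \<inter> V2 = {}")
  case False
  show ?thesis
  proof (cases "\<exists>u v. indep2 u v \<and> h u u = 0 \<and> h v v = 0 \<and> h u v = 0 \<and> (\<forall>x\<in>vec.span {u, v}. lf a x = 0)")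
    case True
    then obtain u v where uv: "indep2 u v" "h u u = 0" "h u v = 0" "h v v = 0"
      and 0: "\<And>x. x \<in> vec.span {u, v} \<Longrightarrow> lf a x = 0" by blast
    obtain e1 e2 where "generator_frame q A u v e1 e2" using ex_frame[OF uv] by blast
    then interpret generator_frame q A u v e1 e2 .
    obtain w where "h w w = 0" "a = polar w" using plane_containing_generator[OF 0] by blast
    then show ?thesis using assms by auto
  next
    case no_gen: False
    obtain p where "p \<noteq> 0" "h p p = 0" using False by (auto simp: V2_def)
    then obtain r where r: "indep2 p r" "h r r = 0" "h r p = 0" "h p p = 0" using ex_generator by blast
    then have "h p r = 0" using h_eq_0_commute by blast
    then obtain e1 e2 where "generator_frame q A p r e1 e2" using ex_frame r by blast
    then interpret generator_frame q A p r e1 e2 .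
    have "card (zero_set (lf a) \<inter> V2) \<le> 1 + 1 + (q\<^sup>2 + 1) * (q * 1)"
      by (rule count_without_generator[OF form_1_lf]) (use no_gen in auto)
    also have "\<dots> = q ^ 3 + q + 2" by (simp add: power2_eq_square power3_eq_cube)
    finally show ?thesis by blast
  qed
qed simp

lemma q_Suc_le: "q + 1 \<le> q\<^sup>2"
proof -
  obtain u where "q = u + 3" using q3 by (metis add.commute le_Suc_ex)
  then show ?thesis by (simp add: power2_eq_square algebra_simps)
qed

lemma plane_section_le:
  assumes "a \<noteq> 0" shows "card (zero_set (lf a) \<inter> V2) \<le> q ^ 3 + q\<^sup>2 + 1"
proof -
  have "q + 1 \<le> q\<^sup>2" by (rule q_Suc_le)
  then show ?thesis using plane_section[OF assms] tangent_section by fastforce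
qed

text \<open>
  If the points of tangency are not orthogonal, then the common line of the planes is a nondegenerate
  Hermitian line; otherwise it is the generator that joins them.
\<close>

lemma tangent_planes_meet:
  assumes u: "u \<noteq> 0" "h u u = 0" and v: "v \<noteq> 0" "h v v = 0" and uv: "indep2 u v"
  shows "card (zero_set (lf (polar u)) \<inter> zero_set (lf (polar v)) \<inter> V2) \<ge> q + 1"
proof -
  let ?S = "zero_set (lf (polar u)) \<inter> zero_set (lf (polar v)) \<inter> V2"
  have mem: "vec.span {x} \<in> ?S" if "x \<noteq> 0" "h x x = 0" "h x u = 0" "h x v = 0" for x
    using that zero_set_form[OF form_1_lf, of x] by (auto simp: V2_def h_def)
  show ?thesis
  proof (cases "h u v = 0")
    case False
    have "q + 1 \<le> card {P. \<exists>x. x \<noteq> 0 \<and> h x x = 0 \<and> h x u = 0 \<and> h x v = 0 \<and> P = vec.span {x}}"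
      by (rule many_isotropic_points[OF u False])
    also have "\<dots> \<le> card ?S" by (rule card_mono) (use mem in auto)
    finally show ?thesis .
  next
    case True
    then have vu: "h v u = 0" using h_eq_0_commute by blast
    have nz: "u + t *s v \<noteq> 0" for t
    proof
      assume "u + t *s v = 0"
      then have "1 *s u + t *s v = 0" by (simp only: vec.scale_one)
      then show False using uv unfolding indep2_def by (metis zero_neq_one)
    qed
    have "inj (\<lambda>t. vec.span {u + t *s v})"
    proof (rule injI)
      fix s t assume "vec.span {u + s *s v} = vec.span {u + t *s v}"
      then obtain k where k: "u + s *s v = k *s (u + t *s v)"
        using span_singleton_eqD[OF _ nz[of s]] by blast
      then have "(1 - k) *s u + (s - k * t) *s v = 0"
        by (simp add: algebra_simps vec.scale_left_diff_distrib vec.scale_right_distrib)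
      then have "1 - k = 0 \<and> s - k * t = 0" using uv unfolding indep2_def by blast
      then show "s = t" by simp
    qed
    then have "q\<^sup>2 = card (range (\<lambda>t. vec.span {u + t *s v}))"
      by (simp add: card_image card_field)
    also have "\<dots> \<le> card ?S"
      by (rule card_mono) (use mem nz u v True vu in auto)
    finally have "q\<^sup>2 \<le> card ?S" .
    moreover have "q + 1 \<le> q\<^sup>2" by (rule q_Suc_le)
    ultimately show ?thesis by linarith
  qed
qed

lemma sections_union:
  assumes "form d f" "d > 0" "form d' g" "d' > 0" "\<And>x. F x = f x * g x" "form d'' F" "d'' > 0"
  shows "zero_set F \<inter> V2 = (zero_set f \<inter> V2) \<union> (zero_set g \<inter> V2)"
proof (rule Set.set_eqI)
  fix P
  show "P \<in> zero_set F \<inter> V2 \<longleftrightarrow> P \<in> (zero_set f \<inter> V2) \<union> (zero_set g \<inter> V2)"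
    unfolding Un_iff mem_section[OF assms(1,2)] mem_section[OF assms(3,4)] mem_section[OF assms(6,7)]
    by (auto simp: assms(5))
qed

lemma finite_points [simp]: "finite (S :: ('k ^ 4) set set)"
  by (rule finite_subset[of _ UNIV]) auto

text \<open>
  Numerically, for \<open>q \<ge> 3\<close>: both bounds of \<open>section_without_plane\<close> for \<open>d = 3\<close> are less than the
  prescribed number, and so are those for \<open>d = 2\<close> increased by the size of a tangent section.
\<close>

lemma form_product_of_planes:
  assumes f: "form 3 f"
    and N: "card (zero_set f \<inter> V2) = 3 * (q ^ 3 + q\<^sup>2 - q) + q + 1"
  shows "\<exists>a b c. \<forall>x. f x = lf a x * (lf b x * lf c x)"
proof -
  \<comment> \<open>written in terms of \<open>q - 3\<close>, the numerical inequalities hold coefficient by coefficient\<close>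
  obtain u where u: "q = u + 3" using q3 by (metis add.commute le_Suc_ex)
  have "\<exists>a. a \<noteq> 0 \<and> (\<forall>x\<in>hyperplane a. f x = 0)"
  proof (rule ccontr)
    assume "\<not> ?thesis"
    then have "card (zero_set f \<inter> V2) \<le> max (3 * q ^ 3 + (3 - 1) * q\<^sup>2 + 1) (3 + 1 + (q\<^sup>2 + 1) * (q * 3))"
      using q3 by (intro section_without_plane[OF f]) auto
    then show False unfolding N by (simp add: u power2_eq_square power3_eq_cube algebra_simps)
  qed
  then obtain a where a: "a \<noteq> 0" "\<And>x. x \<in> hyperplane a \<Longrightarrow> f x = 0" by blast
  obtain g where g: "form 2 g" "\<And>x. f x = lf a x * g x"
  proof -
    have "form (Suc 2) f" using f by simp
    from form_factor[OF this a] show ?thesis using that by blast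
  qed
  have union: "zero_set f \<inter> V2 = (zero_set (lf a) \<inter> V2) \<union> (zero_set g \<inter> V2)"
    by (rule sections_union[OF form_1_lf _ g(1) _ g(2) f]) auto
  have "\<exists>b. b \<noteq> 0 \<and> (\<forall>x\<in>hyperplane b. g x = 0)"
  proof (rule ccontr)
    assume "\<not> ?thesis"
    then have "card (zero_set g \<inter> V2) \<le> max (2 * q ^ 3 + (2 - 1) * q\<^sup>2 + 1) (2 + 1 + (q\<^sup>2 + 1) * (q * 2))"
      using q3 by (intro section_without_plane[OF g(1)]) auto
    moreover have "card (zero_set f \<inter> V2) \<le> card (zero_set (lf a) \<inter> V2) + card (zero_set g \<inter> V2)"
      unfolding union by (rule card_Un_le)
    ultimately have "3 * (q ^ 3 + q\<^sup>2 - q) + q + 1 \<le> q ^ 3 + q\<^sup>2 + 1 +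
        max (2 * q ^ 3 + (2 - 1) * q\<^sup>2 + 1) (2 + 1 + (q\<^sup>2 + 1) * (q * 2))"
      using plane_section_le[OF a(1)] unfolding N by linarith
    then show False by (simp add: u power2_eq_square power3_eq_cube algebra_simps)
  qed
  then obtain b where b: "b \<noteq> 0" "\<And>x. x \<in> hyperplane b \<Longrightarrow> g x = 0" by blast
  obtain l where l: "form 1 l" "\<And>x. g x = lf b x * l x"
  proof -
    have "form (Suc 1) g" using g(1) by (simp add: numeral_2_eq_2)
    from form_factor[OF this b] show ?thesis using that by blast
  qed
  obtain c where "\<And>x. l x = lf c x" using form_lf_eq[OF l(1)] by blast
  then show ?thesis using g(2) l(2) by metis
qed

text \<open>
  Let \<open>M\<close> be the bound for all plane sections and \<open>K\<close> the bound for planes that are not tangent. The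
  prescribed number is \<open>3 M - (2 q + 2)\<close>. Two coincident planes or a plane that is not tangent would lose more
  than \<open>2 q + 2\<close> points. So there are three tangent planes, any two of which share at least \<open>q + 1\<close>
  points. Without a common line, at most one point is common to all three, and at least \<open>3 (q + 1) - 1\<close>
  points are lost. With a common line twice its number of points is lost, which forces this number
  to be \<open>q + 1\<close>.
\<close>

lemma extremal_cubic_form:
  assumes f: "form 3 f" and nz: "\<exists>x. f x \<noteq> 0"
    and N: "card (zero_set f \<inter> V2) = 3 * (q ^ 3 + q\<^sup>2 - q) + q + 1"
  shows "\<exists>u v w. h u u = 0 \<and> h v v = 0 \<and> h w w = 0 \<and> indep2 u v \<and> indep2 u w \<and> indep2 v w \<and>
     (\<forall>x. f x = h x u * (h x v * h x w)) \<and>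
     hyperplane (polar u) \<inter> hyperplane (polar v) \<subseteq> hyperplane (polar w) \<and>
     card (zero_set (lf (polar u)) \<inter> zero_set (lf (polar v)) \<inter> V2) = q + 1"
proof -
  obtain r where r: "q = r + 3" using q3 by (metis add.commute le_Suc_ex)
  obtain a b c where abc: "\<And>x. f x = lf a x * (lf b x * lf c x)"
    using form_product_of_planes[OF f N] by blast
  have nz3: "a \<noteq> 0" "b \<noteq> 0" "c \<noteq> 0" using nz by (auto simp: abc)
  define S where "S a = zero_set (lf a) \<inter> V2" for a
  have memS: "P \<in> S a \<longleftrightarrow> (\<exists>x. x \<noteq> 0 \<and> h x x = 0 \<and> lf a x = 0 \<and> P = vec.span {x})" for P a
    unfolding S_def by (rule mem_section[OF form_1_lf]) simp
  have union: "zero_set f \<inter> V2 = S a \<union> S b \<union> S c"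
  proof -
    have "form 2 (\<lambda>x. lf b x * lf c x)" using form_lf[OF form_1_lf] by (simp add: numeral_2_eq_2)
    then show ?thesis unfolding S_def
      using sections_union[OF form_1_lf _ _ _ abc f] sections_union[OF form_1_lf[of b] _ form_1_lf[of c], of "\<lambda>x. lf b x * lf c x" 2]
      by auto
  qed
  define M where "M = q ^ 3 + q\<^sup>2 + 1"
  define K where "K = q ^ 3 + q + 2"
  have KM: "K + q + 1 < M" "2 * q + 2 < M"
    by (simp_all add: K_def M_def r power2_eq_square power3_eq_cube algebra_simps)
  have le: "card (S x) \<le> M" if "x \<noteq> 0" for x
    using plane_section_le[OF that] by (simp add: S_def M_def)
  have "3 * (q ^ 3 + q\<^sup>2 - q) + q + 1 + (2 * q + 2) = 3 * M"
    by (simp add: M_def r power2_eq_square power3_eq_cube algebra_simps)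
  then have N': "card (S a \<union> S b \<union> S c) + (2 * q + 2) = 3 * M" using N union by simp
  have distinct: "indep2 x y" if "S x \<union> S y \<union> S z = S a \<union> S b \<union> S c" "x \<noteq> 0" "y \<noteq> 0" "z \<noteq> 0" for x y z
  proof (rule ccontr)
    assume "\<not> indep2 x y"
    then obtain \<alpha> \<beta> where ab: "\<alpha> *s x + \<beta> *s y = 0" "\<alpha> \<noteq> 0 \<or> \<beta> \<noteq> 0" unfolding indep2_def by blast
    then have "\<alpha> \<noteq> 0" "\<beta> \<noteq> 0" using that by auto
    have eq: "\<alpha> * lf x v + \<beta> * lf y v = 0" for v
    proof -
      have "lf (\<alpha> *s x + \<beta> *s y) v = 0" unfolding ab(1) by simp
      then show ?thesis by simp
    qed
    have "lf x v = 0 \<longleftrightarrow> lf y v = 0" for v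
      using eq[of v] \<open>\<alpha> \<noteq> 0\<close> \<open>\<beta> \<noteq> 0\<close> by auto
    \<comment> \<open>proportional linear forms define the same plane\<close>
    then have "S x = S y" by (intro Set.set_eqI) (simp add: memS)
    then have "card (S a \<union> S b \<union> S c) \<le> card (S x) + card (S z)"
      using that(1) card_Un_le[of "S x" "S z"] by simp
    then show False using le[OF \<open>x \<noteq> 0\<close>] le[OF \<open>z \<noteq> 0\<close>] N' KM(2) by linarith
  qed
  have ind: "indep2 a b" "indep2 a c" "indep2 b c"
    by (rule distinct[of _ _ c] distinct[of _ _ b] distinct[of _ _ a]; use nz3 in blast)+
  have polar_indep: "indep2 u v" if "indep2 (polar u) (polar v)" for u v
    unfolding indep2_def
  proof (intro allI impI)
    fix \<alpha> \<beta> assume "\<alpha> *s u + \<beta> *s v = 0"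
    then have "polar (\<alpha> *s u + \<beta> *s v) = 0" by simp
    then have "\<alpha> ^ q *s polar u + \<beta> ^ q *s polar v = 0" by (simp only: polar_add polar_scale)
    then have "\<alpha> ^ q = 0 \<and> \<beta> ^ q = 0" using that unfolding indep2_def by blast
    then show "\<alpha> = 0 \<and> \<beta> = 0" by simp
  qed
  have tangent: "\<exists>u. h u u = 0 \<and> x = polar u"
    if xyz: "S x \<union> S y \<union> S z = S a \<union> S b \<union> S c" "x \<noteq> 0" "y \<noteq> 0" "z \<noteq> 0" "indep2 y z" for x y z
  proof (rule ccontr)
    assume nt: "\<not> ?thesis"
    have card_S: "card (S x') \<le> K \<or> (\<exists>u. h u u = 0 \<and> x' = polar u)" if "x' \<noteq> 0" for x'
      using plane_section[OF that] by (auto simp: S_def K_def)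
    have x: "card (S x) \<le> K" using card_S[OF xyz(2)] nt by blast
    have un: "card (S a \<union> S b \<union> S c) \<le> card (S x) + card (S y \<union> S z)"
      unfolding xyz(1)[symmetric] using card_Un_le[of "S x" "S y \<union> S z"] by (simp add: Un_assoc)
    have "card (S y \<union> S z) \<le> M + K \<or> card (S y \<union> S z) + (q + 1) \<le> 2 * M"
    proof (cases "(\<exists>u. h u u = 0 \<and> y = polar u) \<and> (\<exists>u. h u u = 0 \<and> z = polar u)")
      case True
      then obtain u v where uv: "h u u = 0" "y = polar u" "h v v = 0" "z = polar v" by blast
      then have "indep2 u v" using polar_indep xyz(5) by blast
      then have "q + 1 \<le> card (S y \<inter> S z)"
        using tangent_planes_meet[of u v] uv xyz(3,4) by (auto simp: S_def Int_ac)
      moreover have "card (S y \<union> S z) + card (S y \<inter> S z) = card (S y) + card (S z)"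
        by (rule card_Un_Int[symmetric]) auto
      ultimately show ?thesis using le[OF xyz(3)] le[OF xyz(4)] by linarith
    next
      case False
      then have "card (S y) \<le> K \<or> card (S z) \<le> K" using card_S[OF xyz(3)] card_S[OF xyz(4)] by blast
      then show ?thesis
        using le[OF xyz(3)] le[OF xyz(4)] card_Un_le[of "S y" "S z"] by linarith
    qed
    then show False using un x N' KM(1) by linarith
  qed
  have ex: "\<exists>u. h u u = 0 \<and> a = polar u" "\<exists>u. h u u = 0 \<and> b = polar u" "\<exists>u. h u u = 0 \<and> c = polar u"
    by (rule tangent[of _ b c] tangent[of _ a c] tangent[of _ a b]; use nz3 ind in blast)+
  obtain u where u: "h u u = 0" "a = polar u" using ex(1) by blast
  obtain v where v: "h v v = 0" "b = polar v" using ex(2) by blast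
  obtain w where w: "h w w = 0" "c = polar w" using ex(3) by blast
  have uvw: "indep2 u v" "indep2 u w" "indep2 v w" using polar_indep ind u v w by blast+
  have nz_uvw: "u \<noteq> 0" "v \<noteq> 0" "w \<noteq> 0" using nz3 u v w by auto
  have "card (S a \<inter> S b) \<ge> q + 1" "card (S a \<inter> S c) \<ge> q + 1" "card (S b \<inter> S c) \<ge> q + 1"
    using tangent_planes_meet[of u v] tangent_planes_meet[of u w] tangent_planes_meet[of v w]
    using u v w nz_uvw uvw by (auto simp: S_def Int_ac)
  note meet = this
  have ab: "card (S a \<union> S b) + card (S a \<inter> S b) = card (S a) + card (S b)"
    by (rule card_Un_Int[symmetric]) auto
  have abc': "card (S a \<union> S b \<union> S c) + card ((S a \<union> S b) \<inter> S c) = card (S a \<union> S b) + card (S c)"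
    by (rule card_Un_Int[symmetric]) auto
  have sub: "hyperplane a \<inter> hyperplane b \<subseteq> hyperplane c"
  proof (rule ccontr)
    assume not: "\<not> ?thesis"
    have line: "is_line (hyperplane a \<inter> hyperplane b)"
    proof (rule is_line_inter_hyperplanes[OF nz3(1)])
      fix k show "b \<noteq> k *s a"
      proof
        assume "b = k *s a"
        then have "k *s a + (-1) *s b = 0" by simp
        then show False using ind(1) unfolding indep2_def by (metis neg_equal_0_iff_equal zero_neq_one)
      qed
    qed
    have one: "card (S a \<inter> S b \<inter> S c) \<le> 1"
    proof (rule ccontr)
      assume "\<not> ?thesis"
      then obtain P Q where PQ: "P \<in> S a \<inter> S b \<inter> S c" "Q \<in> S a \<inter> S b \<inter> S c" "P \<noteq> Q"
        by (metis card_le_Suc0_iff_eq finite_points One_nat_def)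
      obtain x where x: "x \<noteq> 0" "P = vec.span {x}" using PQ(1) by (auto simp: memS)
      obtain y where y: "y \<noteq> 0" "Q = vec.span {y}" using PQ(2) by (auto simp: memS)
      have mem: "z \<in> hyperplane a \<inter> hyperplane b \<inter> hyperplane c" if "vec.span {z} \<in> S a \<inter> S b \<inter> S c" "z \<noteq> 0" for z
        using that zero_set_form[OF form_1_lf _ that(2)] by (auto simp: S_def hyperplane_def)
      have "indep2 x y"
        unfolding indep2_def
      proof (intro allI impI, rule ccontr)
        fix \<alpha> \<beta> assume eq: "\<alpha> *s x + \<beta> *s y = 0" and "\<not> (\<alpha> = 0 \<and> \<beta> = 0)"
        then have "\<alpha> \<noteq> 0" "\<beta> \<noteq> 0" using x(1) y(1) by auto
        have "\<alpha> *s x = (- \<beta>) *s y" using eq by (simp add: eq_neg_iff_add_eq_0)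
        then have "vec.span {\<alpha> *s x} = vec.span {(- \<beta>) *s y}" by simp
        moreover have "vec.span {\<alpha> *s x} = P" using span_singleton_scale[OF \<open>\<alpha> \<noteq> 0\<close>] x(2) by blast
        moreover have "vec.span {(- \<beta>) *s y} = Q"
          using span_singleton_scale[of "- \<beta>" y] \<open>\<beta> \<noteq> 0\<close> y(2) by simp
        ultimately show False using PQ(3) by simp
      qed
      then have "vec.span {x, y} = hyperplane a \<inter> hyperplane b"
        using mem x y PQ by (intro span_pair_eq_line[OF line]) auto
      moreover have "vec.span {x, y} \<subseteq> hyperplane c"
        using mem x y PQ by (intro vec.span_minimal subspace_hyperplane) auto
      ultimately show False using not by blast
    qed
    have "card ((S a \<union> S b) \<inter> S c) + card (S a \<inter> S b \<inter> S c) = card (S a \<inter> S c) + card (S b \<inter> S c)"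
    proof -
      have "(S a \<union> S b) \<inter> S c = (S a \<inter> S c) \<union> (S b \<inter> S c)" by blast
      moreover have "S a \<inter> S b \<inter> S c = (S a \<inter> S c) \<inter> (S b \<inter> S c)" by blast
      ultimately show ?thesis by (simp only: card_Un_Int[OF finite_points finite_points, symmetric])
    qed
    then show False
      using one meet ab abc' N' q3 le[OF nz3(1)] le[OF nz3(2)] le[OF nz3(3)] by linarith
  qed
  have S_ab_c: "(S a \<union> S b) \<inter> S c \<supseteq> S a \<inter> S b"
  proof
    fix P assume P: "P \<in> S a \<inter> S b"
    then obtain x where x: "x \<noteq> 0" "h x x = 0" "lf a x = 0" "P = vec.span {x}" by (auto simp: memS)
    moreover have "lf b x = 0"
      using P x(4) zero_set_form[OF form_1_lf _ x(1), of b] by (simp add: S_def)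
    ultimately have "lf c x = 0" using sub by (auto simp: hyperplane_def)
    then have "P \<in> S c" using x memS by blast
    then show "P \<in> (S a \<union> S b) \<inter> S c" using P by blast
  qed
  then have "card (S a \<inter> S b) \<le> card ((S a \<union> S b) \<inter> S c)" by (intro card_mono) auto
  then have "card (S a \<inter> S b) = q + 1"
    using meet(1) ab abc' N' le[OF nz3(1)] le[OF nz3(2)] le[OF nz3(3)] by linarith
  moreover have "S a \<inter> S b = zero_set (lf (polar u)) \<inter> zero_set (lf (polar v)) \<inter> V2"
    using u v by (auto simp: S_def)
  ultimately show ?thesis
    using u v w uvw sub abc by (intro exI[of _ u] exI[of _ v] exI[of _ w]) (simp add: h_def)
qed

end

section \<open>Evaluation of polynomials\<close>

text \<open>
  Induction on the variables: as a polynomial in one further variable, of degree less than the size of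
  the field, the sum has vanishing coefficients, and these are sums of the same kind.
\<close>

lemma independent_monomials:
  fixes c :: "'m \<Rightarrow> 'k::{field, finite}" and ex :: "'m \<Rightarrow> 'n \<Rightarrow> nat"
  assumes "finite I" "finite M" "\<And>m i. m \<in> M \<Longrightarrow> ex m i < CARD('k)"
    and "\<And>m m'. m \<in> M \<Longrightarrow> m' \<in> M \<Longrightarrow> (\<And>i. i \<in> I \<Longrightarrow> ex m i = ex m' i) \<Longrightarrow> m = m'"
    and "\<And>x. (\<Sum>m\<in>M. c m * (\<Prod>i\<in>I. x i ^ ex m i)) = 0"
  shows "\<forall>m\<in>M. c m = 0"
  using assms
proof (induction I arbitrary: M rule: finite_induct)
  case empty
  show ?case
  proof
    fix m assume m: "m \<in> M"
    then have "M = {m}" using empty.prems(3) by auto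
    then show "c m = 0" using empty.prems(4)[of undefined] by simp
  qed
next
  case (insert i I)
  show ?case
  proof
    fix m0 assume m0: "m0 \<in> M"
    define M' where "M' = {m \<in> M. ex m i = ex m0 i}"
    have "\<forall>m\<in>M'. c m = 0"
    proof (rule insert.IH)
      show "finite M'" using insert.prems(1) by (simp add: M'_def)
      show "ex m j < CARD('k)" if "m \<in> M'" for m j using that insert.prems(2) by (simp add: M'_def)
      show "m = m'" if "m \<in> M'" "m' \<in> M'" "\<And>i. i \<in> I \<Longrightarrow> ex m i = ex m' i" for m m'
        using that by (intro insert.prems(3)) (auto simp: M'_def)
      fix x :: "'n \<Rightarrow> 'k"
      define P where "P = (\<Sum>m\<in>M. monom (c m * (\<Prod>j\<in>I. x j ^ ex m j)) (ex m i))"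
      have "P = 0"
      proof (rule poly_zero_on_field)
        have "ex m i \<le> CARD('k) - 1" if "m \<in> M" for m
          using insert.prems(2)[OF that, of i] by linarith
        then have "degree P \<le> CARD('k) - 1"
          unfolding P_def using insert.prems(1)
          by (intro degree_sum_le order.trans[OF degree_monom_le]) auto
        then show "degree P < CARD('k)" using zero_less_card_finite[where 'a='k] by linarith
        fix t
        have "(\<Prod>j\<in>I. (x(i := t)) j ^ ex m j) = (\<Prod>j\<in>I. x j ^ ex m j)" for m
          using insert.hyps(2) by (intro prod.cong) auto
        then have "poly P t = (\<Sum>m\<in>M. c m * (\<Prod>j\<in>insert i I. (x(i := t)) j ^ ex m j))"
          using insert.hyps by (simp add: P_def poly_sum poly_monom mult_ac)
        then show "poly P t = 0" using insert.prems(4) by simp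
      qed
      then have "0 = coeff P (ex m0 i)" by simp
      also have "\<dots> = (\<Sum>m\<in>M'. c m * (\<Prod>j\<in>I. x j ^ ex m j))"
        unfolding P_def coeff_sum M'_def using insert.prems(1)
        by (intro sum.mono_neutral_cong_right) auto
      finally show "(\<Sum>m\<in>M'. c m * (\<Prod>j\<in>I. x j ^ ex m j)) = 0" by simp
    qed
    then show "c m0 = 0" using m0 by (simp add: M'_def)
  qed
qed

lemma mp_eval_nonzero:
  fixes F :: "('n::finite, 'k::{field, finite}) mpol"
  assumes "F \<noteq> 0" and hom: "mp_homogeneous d F" and d: "d < CARD('k)"
  shows "\<exists>x. mp_eval F x \<noteq> 0"
proof (rule ccontr)
  assume *: "\<not> ?thesis"
  have "\<forall>m\<in>Poly_Mapping.keys F. Poly_Mapping.lookup F m = 0"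
  proof (rule independent_monomials[of UNIV _ Poly_Mapping.lookup])
    fix m i assume "m \<in> Poly_Mapping.keys F"
    then have "(\<Sum>i\<in>UNIV. Poly_Mapping.lookup m i) = d" using hom by (simp add: mp_homogeneous_def)
    then have "Poly_Mapping.lookup m i \<le> d" by (metis finite UNIV_I member_le_sum zero_le)
    then show "Poly_Mapping.lookup m i < CARD('k)" using d by simp
  next
    fix x :: "'n \<Rightarrow> 'k"
    show "(\<Sum>m\<in>Poly_Mapping.keys F. Poly_Mapping.lookup F m * (\<Prod>i\<in>UNIV. x i ^ Poly_Mapping.lookup m i)) = 0"
      using * by (auto simp: mp_eval_def dest: spec[of _ "\<chi> i. x i"])
  qed (auto intro: poly_mapping_eqI)
  then have "F = 0" by (intro poly_mapping_eqI) (metis in_keys_iff lookup_zero)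
  then show False using assms(1) by simp
qed

lemma mp_eval_superset:
  assumes "finite S" "Poly_Mapping.keys F \<subseteq> S"
  shows "mp_eval F x = (\<Sum>m\<in>S. Poly_Mapping.lookup F m * (\<Prod>i\<in>UNIV. (x $ i) ^ Poly_Mapping.lookup m i))"
  unfolding mp_eval_def using assms by (intro sum.mono_neutral_left) (auto simp: in_keys_iff)

lemma mp_eval_add: "mp_eval (F + G) x = mp_eval F x + mp_eval G x"
proof -
  let ?S = "Poly_Mapping.keys F \<union> Poly_Mapping.keys G"
  show ?thesis
    using keys_add[of F G]
    by (simp add: mp_eval_superset[of ?S] lookup_add distrib_right sum.distrib)
qed

lemma mp_eval_0: "mp_eval 0 x = 0"
  by (simp add: mp_eval_def)

lemma mp_eval_sum: "mp_eval (\<Sum>i\<in>I. F i) x = (\<Sum>i\<in>I. mp_eval (F i) x)"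
  by (induction I rule: infinite_finite_induct) (simp_all add: mp_eval_add mp_eval_0)

lemma mp_eval_single:
  "mp_eval (Poly_Mapping.single m c) x = c * (\<Prod>i\<in>UNIV. (x $ i) ^ Poly_Mapping.lookup m i)"
  by (subst mp_eval_superset[of "{m}"]) auto

text \<open>
  Extending the range of summation turns the definition into an expression that is additive in the
  polynomial.
\<close>

lemma mp_pderiv_superset:
  assumes "finite S" "Poly_Mapping.keys F \<subseteq> S"
  shows "mp_pderiv i F = (\<Sum>m\<in>S. Poly_Mapping.single (m - Poly_Mapping.single i 1)
          (of_nat (Poly_Mapping.lookup m i) * Poly_Mapping.lookup F m))"
  unfolding mp_pderiv_def using assms by (intro sum.mono_neutral_left) (auto simp: in_keys_iff)

lemma mp_pderiv_add: "mp_pderiv i (F + G) = mp_pderiv i F + mp_pderiv i G"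
proof -
  let ?S = "Poly_Mapping.keys F \<union> Poly_Mapping.keys G"
  show ?thesis
    using keys_add[of F G]
    by (simp add: mp_pderiv_superset[of ?S] lookup_add distrib_left single_add sum.distrib)
qed

lemma mp_pderiv_0: "mp_pderiv i 0 = 0"
  by (simp add: mp_pderiv_def)

lemma mp_pderiv_sum: "mp_pderiv i (\<Sum>j\<in>I. F j) = (\<Sum>j\<in>I. mp_pderiv i (F j))"
  by (induction I rule: infinite_finite_induct) (simp_all add: mp_pderiv_add mp_pderiv_0)

lemma mp_pderiv_single:
  "mp_pderiv i (Poly_Mapping.single m c) =
     Poly_Mapping.single (m - Poly_Mapping.single i 1) (of_nat (Poly_Mapping.lookup m i) * c)"
  by (subst mp_pderiv_superset[of "{m}"]) auto

lemma hermitian_term: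
  fixes i j :: 'n and a :: "'k::field"
  shows "mp_var i * mp_const a * mp_var j ^ n =
     Poly_Mapping.single (Poly_Mapping.single i 1 + Poly_Mapping.single j n) a"
proof -
  have "(mp_var j :: ('n, 'k) mpol) ^ n = Poly_Mapping.single (Poly_Mapping.single j n) 1"
    by (induction n) (simp_all add: mp_var_def mult_single flip: single_add)
  then show ?thesis by (simp only:) (simp add: mp_var_def mp_const_def mult_single)
qed

lemma prod_power_single:
  "(\<Prod>k\<in>(UNIV :: 'n::finite set). y k ^ Poly_Mapping.lookup (Poly_Mapping.single i n) k) = (y i ^ n :: 'k::field)"
proof -
  have "(\<Prod>k\<in>UNIV. y k ^ Poly_Mapping.lookup (Poly_Mapping.single i n) k) =
      (\<Prod>k\<in>UNIV. if k = i then y i ^ n else 1)"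
    by (rule prod.cong) (auto simp: lookup_single when_def)
  then show ?thesis by simp
qed

section \<open>Passage to the algebraic closure\<close>

definition ac_vec :: "'k::field ^ 'n::finite \<Rightarrow> 'k alg_closure ^ 'n" where
  "ac_vec x = (\<chi> i. to_ac (x $ i))"

lemma lf_ac_vec: "lf (ac_vec a) (ac_vec x) = to_ac (lf a x)"
  by (simp add: lf_def ac_vec_def to_ac_sum)

text \<open>
  The coordinates are released from the small field one at a time. Along a coordinate line, \<open>G\<close> is a
  polynomial of degree at most \<open>d\<close>, and it has more than \<open>d\<close> zeros with coordinates in the small
  field.
\<close>

lemma form_zero_extends:
  fixes G :: "'k::{field, finite} alg_closure ^ 'n::finite \<Rightarrow> 'k alg_closure"
  assumes G: "form d G" and d: "d < CARD('k)" and zero: "\<And>x. G (ac_vec x) = 0"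
  shows "G z = 0"
proof -
  have "\<forall>z. (\<forall>i. i \<notin> I \<longrightarrow> z $ i \<in> range to_ac) \<longrightarrow> G z = 0" if "finite I" for I :: "'n set"
    using that
  proof (induction I)
    case empty
    show ?case
    proof (intro allI impI)
      fix z :: "'k alg_closure ^ 'n" assume "\<forall>i. i \<notin> {} \<longrightarrow> z $ i \<in> range to_ac"
      then have "\<forall>i. \<exists>c. z $ i = to_ac c" by auto
      then obtain c where "\<And>i. z $ i = to_ac (c i)" by metis
      then have "z = ac_vec (\<chi> i. c i)" by (simp add: ac_vec_def vec_eq_iff)
      then show "G z = 0" using zero by simp
    qed
  next
    case (insert i I)
    show ?case
    proof (intro allI impI)
      fix z :: "'k alg_closure ^ 'n" assume z: "\<forall>j. j \<notin> insert i I \<longrightarrow> z $ j \<in> range to_ac"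
      obtain p where p: "degree p \<le> d" "\<And>t. G (z + t *s axis i 1) = poly p t"
        using form_line_poly[OF G] by metis
      have root: "poly p (to_ac c - z $ i) = 0" for c
      proof -
        have "\<forall>j. j \<notin> I \<longrightarrow> (z + (to_ac c - z $ i) *s axis i 1) $ j \<in> range to_ac"
          using z by (auto simp: axis_def)
        then show ?thesis using insert.IH p(2) by metis
      qed
      have "p = 0"
      proof (rule ccontr)
        assume "p \<noteq> 0"
        have "CARD('k) = card (range (\<lambda>c. to_ac c - z $ i))"
          by (subst card_image) (auto intro!: injI)
        also have "\<dots> \<le> card {t. poly p t = 0}"
          using root poly_roots_finite[OF \<open>p \<noteq> 0\<close>] by (intro card_mono) auto
        also have "\<dots> \<le> d" using card_poly_roots_bound[OF \<open>p \<noteq> 0\<close>] p(1) by linarith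
        finally show False using d by simp
      qed
      then show "G z = 0" using p(2)[of 0] by simp
    qed
  qed
  from this[OF finite[of UNIV]] show ?thesis by simp
qed

lemma keys_map_to_ac: "Poly_Mapping.keys (Poly_Mapping.map to_ac F) = Poly_Mapping.keys (F :: 'm \<Rightarrow>\<^sub>0 'k::field)"
  and lookup_map_to_ac: "Poly_Mapping.lookup (Poly_Mapping.map to_ac F) m = to_ac (Poly_Mapping.lookup F m)"
proof -
  show *: "Poly_Mapping.lookup (Poly_Mapping.map to_ac F) m = to_ac (Poly_Mapping.lookup F m)" for m
    by (simp add: map.rep_eq when_def)
  show "Poly_Mapping.keys (Poly_Mapping.map to_ac F) = Poly_Mapping.keys F"
    by (simp add: set_eq_iff in_keys_iff *)
qed

lemma mp_eval_ac_vec: "mp_eval (Poly_Mapping.map to_ac F) (ac_vec x) = to_ac (mp_eval F x)"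
  by (simp add: mp_eval_def keys_map_to_ac lookup_map_to_ac to_ac_sum to_ac_prod ac_vec_def)

lemma mp_eval_ac_product:
  fixes F :: "('n::finite, 'k::{field, finite}) mpol"
  assumes hom: "mp_homogeneous 3 F" and card: "3 < CARD('k)"
    and F: "\<And>x. mp_eval F x = lf a x * (lf b x * lf c x)"
  shows "mp_eval (Poly_Mapping.map to_ac F) z = lf (ac_vec a) z * (lf (ac_vec b) z * lf (ac_vec c) z)"
proof -
  let ?G = "\<lambda>z. mp_eval (Poly_Mapping.map to_ac F) z + (-1) * (lf (ac_vec a) z * (lf (ac_vec b) z * lf (ac_vec c) z))"
  have "mp_homogeneous 3 (Poly_Mapping.map to_ac F)"
    using hom by (simp add: mp_homogeneous_def keys_map_to_ac)
  moreover have "form 3 (\<lambda>z. lf (ac_vec a) z * (lf (ac_vec b) z * lf (ac_vec c) z))"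
    using form_lf[OF form_lf[OF form_1_lf]] by (simp add: numeral_3_eq_3)
  ultimately have form: "form 3 ?G" by (intro form_add form_smult form_mp_eval)
  have zero: "?G (ac_vec x) = 0" for x by (simp add: mp_eval_ac_vec F lf_ac_vec)
  have "?G z = 0" by (rule form_zero_extends[OF form card zero])
  then show ?thesis by simp
qed

text \<open>
  If \<open>a $ j \<noteq> 0\<close>, then the hyperplane is spanned by the vectors \<open>axis i 1 - (a $ i / a $ j) *s axis j 1\<close>,
  which are defined over the small field.
\<close>

lemma extend_ac_hyperplane:
  fixes a :: "'k::field ^ 'n::finite"
  assumes "a \<noteq> 0"
  shows "extend_ac (hyperplane a) = hyperplane (ac_vec a)"
proof
  have image: "(\<lambda>x. \<chi> i. to_ac (x $ i)) = (ac_vec :: 'k ^ 'n \<Rightarrow> _)" by (simp add: ac_vec_def fun_eq_iff)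
  show "extend_ac (hyperplane a) \<subseteq> hyperplane (ac_vec a)"
    unfolding extend_ac_def image
    by (intro vec.span_minimal subspace_hyperplane) (auto simp: hyperplane_def lf_ac_vec)
  show "hyperplane (ac_vec a) \<subseteq> extend_ac (hyperplane a)"
  proof
    fix z assume z: "z \<in> hyperplane (ac_vec a)"
    obtain j where j: "a $ j \<noteq> 0" using assms by (auto simp: vec_eq_iff)
    define v where "v i = axis i 1 - (a $ i / a $ j) *s axis j 1" for i
    have "v i \<in> hyperplane a" for i using j by (simp add: v_def hyperplane_def lf_axis)
    then have "(\<Sum>i\<in>UNIV. z $ i *s ac_vec (v i)) \<in> extend_ac (hyperplane a)"
      unfolding extend_ac_def image by (intro vec.span_sum vec.span_scale vec.span_base) auto
    also have "(\<Sum>i\<in>UNIV. z $ i *s ac_vec (v i)) = z"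
    proof (rule vec_eq_iff[THEN iffD2], rule allI)
      fix k
      have "(\<Sum>i\<in>UNIV. z $ i *s ac_vec (v i)) $ k =
          (\<Sum>i\<in>UNIV. (if i = k then z $ k else 0) - to_ac (a $ i) * z $ i * (if k = j then 1 / to_ac (a $ j) else 0))"
        unfolding sum_component by (rule sum.cong) (auto simp: ac_vec_def v_def axis_def algebra_simps)
      also have "\<dots> = z $ k - lf (ac_vec a) z * (if k = j then 1 / to_ac (a $ j) else 0)"
        unfolding sum_subtractf sum_distrib_right[symmetric] by (simp add: lf_def ac_vec_def)
      also have "\<dots> = z $ k" using z by (simp add: hyperplane_def)
      finally show "(\<Sum>i\<in>UNIV. z $ i *s ac_vec (v i)) $ k = z $ k" .
    qed
    finally show "z \<in> extend_ac (hyperplane a)" .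
  qed
qed

section \<open>Extremal cubic surfaces\<close>

context hermitian_surface
begin

lemma mp_eval_hermitian: "mp_eval (hermitian_pol q A) x = h x x"
proof -
  have "mp_eval (hermitian_pol q A) x = (\<Sum>i\<in>UNIV. \<Sum>j\<in>UNIV. A $ i $ j * (x $ i * x $ j ^ q))"
    by (simp add: hermitian_pol_def hermitian_term mp_eval_sum mp_eval_single lookup_add power_add
        prod.distrib prod_power_single del: One_nat_def)
  then show ?thesis
    by (simp add: h_def lf_def polar_def sum_distrib_left mult_ac)
qed

text \<open>
  The derivative of \<open>x\<^sub>j\<^sup>q\<close> is zero, so only the linear factor of each term contributes, and the
  gradient is the polar vector.
\<close>

lemma mp_pderiv_hermitian: "mp_eval (mp_pderiv k (hermitian_pol q A)) x = polar x $ k"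
proof -
  have pd: "mp_eval (mp_pderiv k (Poly_Mapping.single (Poly_Mapping.single i 1 + Poly_Mapping.single j q) (A $ i $ j))) x
      = (if i = k then A $ k $ j * x $ j ^ q else 0)" for i j
  proof -
    have "of_nat (Poly_Mapping.lookup (Poly_Mapping.single i 1 + Poly_Mapping.single j q) k) =
        (if i = k then 1 else 0 :: 'k)"
      by (auto simp: lookup_add lookup_single when_def of_nat_q)
    then have "mp_pderiv k (Poly_Mapping.single (Poly_Mapping.single i 1 + Poly_Mapping.single j q) (A $ i $ j))
        = (if i = k then Poly_Mapping.single (Poly_Mapping.single j q) (A $ k $ j) else 0)"
      by (simp only: mp_pderiv_single) simp
    then show ?thesis by (simp add: mp_eval_0 mp_eval_single prod_power_single)
  qed
  have "mp_eval (mp_pderiv k (hermitian_pol q A)) x =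
      (\<Sum>i\<in>UNIV. \<Sum>j\<in>UNIV. if i = k then A $ k $ j * x $ j ^ q else 0)"
    by (simp only: hermitian_pol_def hermitian_term mp_pderiv_sum mp_eval_sum pd)
  also have "\<dots> = (\<Sum>i\<in>UNIV. if i = k then polar x $ k else 0)"
    by (rule sum.cong) (auto simp: polar_def)
  finally show ?thesis by simp
qed

lemma zero_points_hermitian: "zero_points (hermitian_pol q A) = V2"
proof (rule Set.set_eqI)
  fix P
  have "(\<forall>y\<in>vec.span {x}. h y y = 0) \<longleftrightarrow> h x x = 0" for x
    using vec.span_base[of x "{x}"] by (auto simp: vec.span_singleton)
  then show "P \<in> zero_points (hermitian_pol q A) \<longleftrightarrow> P \<in> V2"
    unfolding zero_points_def V2_def mp_eval_hermitian
    by (auto simp: proj_points_iff[OF vec.subspace_UNIV])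
qed

lemma tangent_space_hermitian: "tangent_space (hermitian_pol q A) (vec.span {u}) = hyperplane (polar u)"
proof -
  have "(\<forall>p\<in>vec.span {u}. h x p = 0) \<longleftrightarrow> h x u = 0" for x
    using vec.span_base[of u "{u}"] by (auto simp: vec.span_singleton)
  then show ?thesis
    unfolding tangent_space_def mp_pderiv_hermitian hyperplane_polar
    by (simp add: h_def lf_def)
qed

lemma is_tangent_plane_polar:
  assumes "u \<noteq> 0" "h u u = 0"
  shows "is_tangent_plane (hermitian_pol q A) (hyperplane (polar u))"
proof -
  have "vec.span {u} \<in> V2" using assms by (auto simp: V2_def)
  then show ?thesis
    unfolding is_tangent_plane_def zero_points_hermitian
    using is_plane_hyperplane[of "polar u"] assms(1) tangent_space_hermitian by auto
qed

lemma is_line_inter_tangent: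
  assumes "indep2 u v"
  shows "is_line (hyperplane (polar u) \<inter> hyperplane (polar v))"
proof (rule is_line_inter_hyperplanes)
  have *: "\<alpha> *s u + \<beta> *s v = 0 \<Longrightarrow> \<alpha> = 0 \<and> \<beta> = 0" for \<alpha> \<beta>
    using assms unfolding indep2_def by blast
  show "polar u \<noteq> 0" using *[of 1 0] by auto
  fix c show "polar v \<noteq> c *s polar u"
  proof
    assume "polar v = c *s polar u"
    have "polar (c ^ q *s u + (-1) *s v) = (c ^ q) ^ q *s polar u + (-1) ^ q *s polar v"
      by (simp only: polar_add polar_scale)
    also have "\<dots> = 0" using \<open>polar v = c *s polar u\<close> by (simp add: frob_minus)
    finally have "polar (c ^ q *s u + (-1) *s v) = 0" .
    then have "c ^ q *s u + (-1) *s v = 0" by (simp only: polar_eq_0_iff)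
    from *[OF this] show False by simp
  qed
qed

lemma tangent_planes_distinct:
  assumes "indep2 u v" shows "hyperplane (polar u) \<noteq> hyperplane (polar v)"
proof
  assume *: "hyperplane (polar u) = hyperplane (polar v)"
  have "polar u \<noteq> 0" using assms[unfolded indep2_def, rule_format, of 1 0] by auto
  then have "is_plane (hyperplane (polar u))" by (rule is_plane_hyperplane)
  then show False using is_line_inter_tangent[OF assms] * by (simp add: is_plane_def is_line_def)
qed

lemma extremal_cubic:
  fixes F :: "(4, 'k) mpol"
  assumes F: "F \<noteq> 0" "mp_homogeneous 3 F"
    and N: "card (zero_points F \<inter> zero_points (hermitian_pol q A)) = 3 * (q ^ 3 + q ^ 2 - q) + q + 1"
  shows "\<exists>T L. card T = 3 \<and> (\<forall>W\<in>T. is_tangent_plane (hermitian_pol q A) W) \<and>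
           is_line L \<and> (\<forall>W\<in>T. L \<subseteq> W) \<and>
           card (proj_points L \<inter> zero_points (hermitian_pol q A)) = q + 1 \<and>
           zero_points_ac F = (\<Union>W\<in>T. proj_points (extend_ac W))"
proof -
  have card: "3 < CARD('k)" using q_Suc_le q3 by (simp add: card_field)
  have "card (zero_set (mp_eval F) \<inter> V2) = 3 * (q ^ 3 + q\<^sup>2 - q) + q + 1"
    using N by (simp add: zero_points_hermitian) (simp add: zero_points_def zero_set_def)
  from extremal_cubic_form[OF form_mp_eval[OF F(2)] mp_eval_nonzero[OF F card] this]
  obtain u v w where iso: "h u u = 0" "h v v = 0" "h w w = 0"
    and ind: "indep2 u v" "indep2 u w" "indep2 v w"
    and eval: "\<And>x. mp_eval F x = h x u * (h x v * h x w)"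
    and sub: "hyperplane (polar u) \<inter> hyperplane (polar v) \<subseteq> hyperplane (polar w)"
    and L: "card (zero_set (lf (polar u)) \<inter> zero_set (lf (polar v)) \<inter> V2) = q + 1"
    by blast
  have nz: "u \<noteq> 0" "v \<noteq> 0" "w \<noteq> 0"
    using ind(1)[unfolded indep2_def, rule_format, of 1 0] ind(1)[unfolded indep2_def, rule_format, of 0 1]
      ind(2)[unfolded indep2_def, rule_format, of 0 1] by auto
  let ?T = "{hyperplane (polar u), hyperplane (polar v), hyperplane (polar w)}"
  let ?L = "hyperplane (polar u) \<inter> hyperplane (polar v)"
  have "card ?T = 3" using tangent_planes_distinct ind by simp
  moreover have "\<forall>W\<in>?T. is_tangent_plane (hermitian_pol q A) W"
    using is_tangent_plane_polar nz iso by blast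
  moreover have line: "is_line ?L" by (rule is_line_inter_tangent) fact
  moreover have "\<forall>W\<in>?T. ?L \<subseteq> W" using sub by blast
  moreover have "card (proj_points ?L \<inter> zero_points (hermitian_pol q A)) = q + 1"
  proof -
    have "proj_points ?L = zero_set (lf (polar u)) \<inter> zero_set (lf (polar v))"
      by (auto simp: zero_set_def proj_points_def hyperplane_def)
    then show ?thesis using L by (simp add: zero_points_hermitian)
  qed
  moreover have "zero_points_ac F = (\<Union>W\<in>?T. proj_points (extend_ac W))"
  proof (rule Set.set_eqI)
    fix P :: "('k alg_closure ^ 4) set"
    have prod: "mp_eval (Poly_Mapping.map to_ac F) z =
        lf (ac_vec (polar u)) z * (lf (ac_vec (polar v)) z * lf (ac_vec (polar w)) z)" for z
      by (rule mp_eval_ac_product[OF F(2) card]) (simp add: eval h_def)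
    have "P \<in> zero_points_ac F \<longleftrightarrow> (\<exists>x. x \<noteq> 0 \<and> P = vec.span {x} \<and>
        (lf (ac_vec (polar u)) x = 0 \<or> lf (ac_vec (polar v)) x = 0 \<or> lf (ac_vec (polar w)) x = 0))"
    proof -
      have "(\<forall>y\<in>vec.span {x}. mp_eval (Poly_Mapping.map to_ac F) y = 0) \<longleftrightarrow>
          lf (ac_vec (polar u)) x = 0 \<or> lf (ac_vec (polar v)) x = 0 \<or> lf (ac_vec (polar w)) x = 0" for x
        using vec.span_base[of x "{x}"] by (auto simp: vec.span_singleton prod)
      then show ?thesis
        unfolding zero_points_ac_def zero_points_def
        by (auto simp: proj_points_iff[OF vec.subspace_UNIV])
    qed
    also have "\<dots> \<longleftrightarrow> P \<in> (\<Union>W\<in>?T. proj_points (extend_ac W))"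
    proof -
      have "(\<Union>W\<in>?T. proj_points (extend_ac W)) = proj_points (hyperplane (ac_vec (polar u))) \<union>
          (proj_points (hyperplane (ac_vec (polar v))) \<union> proj_points (hyperplane (ac_vec (polar w))))"
        using nz by (simp add: extend_ac_hyperplane)
      then show ?thesis
        by (simp only: Un_iff proj_points_iff[OF subspace_hyperplane]) (auto simp: hyperplane_def)
    qed
    finally show "P \<in> zero_points_ac F \<longleftrightarrow> P \<in> (\<Union>W\<in>?T. proj_points (extend_ac W))" .
  qed
  ultimately show ?thesis by blast
qed

end

theorem corollary5p4:
  fixes q :: nat
    and A :: "'a::{field,finite} ^ 4 ^ 4"
    and F :: "(4, 'a) mpol"
  assumes "primepow q" and "q \<ge> 3"
    and "CARD('a) = q\<^sup>2"
    and "nondeg_hermitian q A"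
    and "F \<noteq> 0" and "mp_homogeneous 3 F"
    and "card (zero_points F \<inter> zero_points (hermitian_pol q A)) = 3 * (q ^ 3 + q ^ 2 - q) + q + 1"
  shows "\<exists>T L. card T = 3 \<and> (\<forall>W\<in>T. is_tangent_plane (hermitian_pol q A) W) \<and>
           is_line L \<and> (\<forall>W\<in>T. L \<subseteq> W) \<and>
           card (proj_points L \<inter> zero_points (hermitian_pol q A)) = q + 1 \<and>
           zero_points_ac F = (\<Union>W\<in>T. proj_points (extend_ac W))"
proof -
  interpret hermitian_surface q A using assms(1-4) by unfold_locales
  show ?thesis by (rule extremal_cubic[OF assms(5-7)])
qed

end
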